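(* Let $G$ and $H$ be finite groups and let $m$ be a positive integer. If $P(G)\cong P(H)$, $H$ has a normal Hall subgroup of order $m$, and $G$ is solvable, then $G$ also has a normal Hall subgroup of order $m$.
   Context: For a finite group $G$, the (undirected) power graph $P(G)$ is the graph with vertex set $G$ in which two vertices $a,b$ are adjacent if and only if $a\neq b$ and $a^k=b$ or $b^k=a$ for some positive integer $k$. The symbol $\cong$ between graphs denotes graph isomorphism. A subgroup of a finite group is a Hall subgroup if its order and its index are relatively prime. *)

theory Defs
  imports "HOL-Algebra.Algebra" "Graph_Theory.Graph_Theory"
begin

text \<open>
  Following \<^theory>\<open>Graph_Theory.Digraph\<close>, an undirected simple graph is a symmetric loop-free
  digraph: the edge joining \<open>a\<close> and \<open>b\<close> is represented by the two arcs \<open>(a, b)\<close> and \<open>(b, a)\<close>.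
\<close>

definition power_graph :: "('a, 'm) monoid_scheme \<Rightarrow> 'a pair_pre_digraph" where
  "power_graph G =
    \<lparr>pverts = carrier G,
     parcs = {(a, b). a \<in> carrier G \<and> b \<in> carrier G \<and> a \<noteq> b \<and>
       (\<exists>k::nat. k > 0 \<and> (a [^]\<^bsub>G\<^esub> k = b \<or> b [^]\<^bsub>G\<^esub> k = a))}\<rparr>"

lemma power_graph_is_graph:
  assumes "finite (carrier G)"
  shows "graph (with_proj (power_graph G))"
proof -
  have fin: "finite (parcs (power_graph G))"
    by (rule finite_subset[of _ "carrier G \<times> carrier G"])
       (auto simp: power_graph_def assms)
  interpret pair_graph "power_graph G"
    using fin assms
    by unfold_locales (auto simp: power_graph_def symmetric_def sym_def)
  show ?thesis by unfold_locales
qed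

text \<open>
  The isomorphisms of \<^const>\<open>digraph_iso\<close> also map arcs; on graphs whose arcs are pairs of vertices
  they amount to the adjacency-preserving and -reflecting bijections of the vertices.
\<close>

lemma digraph_iso_with_proj_iff:
  assumes "pair_wf_digraph A" "pair_wf_digraph B"
  shows "digraph_iso (with_proj A) (with_proj B) \<longleftrightarrow>
    (\<exists>f. bij_betw f (pverts A) (pverts B) \<and>
      (\<forall>a\<in>pverts A. \<forall>b\<in>pverts A. (a, b) \<in> parcs A \<longleftrightarrow> (f a, f b) \<in> parcs B))"
    (is "?L \<longleftrightarrow> ?R")
proof
  assume ?L
  then obtain h where h: "pre_digraph.digraph_isomorphism (with_proj A) h"
    and B: "with_proj B = app_iso h (with_proj A)"
    by (auto simp: digraph_iso_def)
  define f where "f = iso_verts h"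
  have v: "pverts B = f ` pverts A" and inj: "inj_on f (pverts A)"
    and arcs: "parcs B = iso_arcs h ` parcs A"
    and "iso_tail h = fst" "iso_head h = snd"
    using arg_cong[OF B, of verts] arg_cong[OF B, of arcs]
      arg_cong[OF B, of tail] arg_cong[OF B, of head] h
    by (auto simp: f_def pre_digraph.digraph_isomorphism_def)
  then have "iso_arcs h e = (f (fst e), f (snd e))" if "e \<in> parcs A" for e
    using h that by (auto simp: pre_digraph.digraph_isomorphism_def f_def prod_eq_iff)
  then have arcs': "parcs B = (\<lambda>e. (f (fst e), f (snd e))) ` parcs A"
    using arcs by auto
  have "(a, b) \<in> parcs A \<longleftrightarrow> (f a, f b) \<in> parcs B" if "a \<in> pverts A" "b \<in> pverts A" for a b
  proof
    assume "(a, b) \<in> parcs A"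
    then show "(f a, f b) \<in> parcs B" unfolding arcs' by (rule rev_image_eqI) simp
  next
    assume "(f a, f b) \<in> parcs B"
    then obtain c d where cd: "(c, d) \<in> parcs A" "f a = f c" "f b = f d"
      unfolding arcs' by auto
    moreover have "c \<in> pverts A" "d \<in> pverts A"
      using pair_wf_digraph.wellformed'[OF assms(1)] cd(1) by blast+
    ultimately show "(a, b) \<in> parcs A" using that inj by (metis inj_onD)
  qed
  with v inj show ?R by (auto simp: bij_betw_def)
next
  assume ?R
  then obtain f where f: "bij_betw f (pverts A) (pverts B)"
    and adj: "\<And>a b. a \<in> pverts A \<Longrightarrow> b \<in> pverts A \<Longrightarrow>
      (a, b) \<in> parcs A \<longleftrightarrow> (f a, f b) \<in> parcs B"
    by blast
  define h where "h = \<lparr>iso_verts = f, iso_arcs = (\<lambda>e. (f (fst e), f (snd e))),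
    iso_head = snd, iso_tail = fst\<rparr>"
  note wfA = pair_wf_digraph.wellformed'[OF assms(1)]
  note wfB = pair_wf_digraph.wellformed'[OF assms(2)]
  have inj: "inj_on f (pverts A)" and v: "f ` pverts A = pverts B"
    using f by (auto simp: bij_betw_def)
  have "inj_on (\<lambda>e. (f (fst e), f (snd e))) (parcs A)"
  proof (rule inj_onI)
    fix d e assume "d \<in> parcs A" "e \<in> parcs A" "(f (fst d), f (snd d)) = (f (fst e), f (snd e))"
    then show "d = e"
      using inj wfA[of "fst d" "snd d"] wfA[of "fst e" "snd e"]
      by (simp add: prod_eq_iff inj_on_eq_iff)
  qed
  then have iso: "pre_digraph.digraph_isomorphism (with_proj A) h"
    using inj assms(1)
    by (auto simp: pre_digraph.digraph_isomorphism_def h_def wf_digraph_wp_iff)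
  have "(\<lambda>e. (f (fst e), f (snd e))) ` parcs A = parcs B"
  proof (intro equalityI subsetI)
    fix e assume "e \<in> (\<lambda>e. (f (fst e), f (snd e))) ` parcs A"
    then obtain a b where "(a, b) \<in> parcs A" "e = (f a, f b)" by auto
    then show "e \<in> parcs B" using adj[of a b] wfA[of a b] by simp
  next
    fix e assume e: "e \<in> parcs B"
    then have "fst e \<in> f ` pverts A" "snd e \<in> f ` pverts A"
      using wfB[of "fst e" "snd e"] v by auto
    then obtain a b where ab: "a \<in> pverts A" "b \<in> pverts A" "fst e = f a" "snd e = f b"
      by blast
    then have "e = (f a, f b)" by (simp add: prod_eq_iff)
    moreover from this have "(a, b) \<in> parcs A" using e ab adj[of a b] by simp
    ultimately show "e \<in> (\<lambda>e. (f (fst e), f (snd e))) ` parcs A"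
      by (intro image_eqI[of _ _ "(a, b)"]) simp_all
  qed
  then have "with_proj B = app_iso h (with_proj A)"
    using v by (auto simp: app_iso_def with_proj_def h_def)
  with iso show ?L by (auto simp: digraph_iso_def)
qed

text \<open>Only meaningful for finite \<open>G\<close>; the index of \<open>K\<close> is the number of its right cosets.\<close>

definition hall_subgroup :: "'a set \<Rightarrow> ('a, 'm) monoid_scheme \<Rightarrow> bool" where
  "hall_subgroup K G \<longleftrightarrow> subgroup K G \<and> coprime (card K) (card (rcosets\<^bsub>G\<^esub> K))"

end

theory Submission
  imports Defs "HOL-Number_Theory.Totient"
begin

text \<open>
  The proof has two independent parts. First, an isomorphism of power graphs preserves the number
  of solutions of \<open>x\<^sup>m = 1\<close>. After composing it with a transposition it fixes the identity, and then
  it maps every maximal cyclic subgroup onto a cyclic subgroup: comparing the sizes of closed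
  neighbourhoods and of classes of vertices with equal closed neighbourhood excludes the
  alternatives. By inclusion-exclusion over the cover by maximal cyclic subgroups, whose
  intersections are again cyclic and of the same order in both groups, the solutions can be counted.

  Second, in \<open>H\<close> the normal Hall subgroup is the set of solutions of \<open>x\<^sup>m = 1\<close>, so \<open>G\<close> has at most
  \<open>m\<close> of them. For solvable \<open>G\<close>, induct along a quotient by an abelian normal subgroup \<open>N\<close> of
  exponent dividing \<open>m\<close> or \<open>n\<close>, where the order of \<open>G\<close> is \<open>m n\<close>. In the latter case each coset
  of \<open>N\<close> in the preimage of the Hall subgroup of the quotient contains exactly one solution, so that
  \<open>N\<close> centralizes the solutions, \<open>N\<close> is central in the preimage, and the transfer splits it off.
\<close>

hide_const (open) Divisibility.prime

subsection \<open>Divisors and the totient function\<close>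

text \<open>With n = d t and g = gcd(d, t), the identity phi(n) phi(g) = phi(d) phi(t) g becomes
  phi(g) = phi(t) g. Since phi(g) is at most g, this forces phi(t) = 1 and g = 1.\<close>

lemma totient_eq_dvd_cases:
  fixes d n :: nat
  assumes "d dvd n" "n > 0" "totient d = totient n"
  shows "d = n \<or> (n = 2 * d \<and> odd d)"
proof -
  obtain t where t: "n = d * t" using assms(1) by blast
  define g where "g = gcd d t"
  have pos: "d > 0" "t > 0" "g > 0" using assms(2) t by (auto simp: g_def)
  have "totient n * totient g = totient d * totient t * g"
    unfolding t g_def by (rule totient_gcd)
  then have eq: "totient g = totient t * g"
    using assms(2,3) pos by simp
  have "totient t * g \<le> 1 * g"
    using totient_le[of g] eq by simp
  then have t1: "totient t \<le> 1" using pos by simp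
  then have "totient t = 1" using pos totient_gt_0_iff[of t] by linarith
  then have "g = 1" using totient_less[of g] eq pos by (cases "g = 1") auto
  have "t \<le> 2" using t1 totient_gt_1[of t] by (cases "t > 2") auto
  then consider "t = 1" | "t = 2" using pos by linarith
  then show ?thesis
    using \<open>g = 1\<close> t by cases (auto simp: g_def coprime_iff_gcd_eq_1)
qed

text \<open>In other words, at least half of the elements of a nontrivial cyclic p-group are
  generators.\<close>

lemma two_totient_prime_power_ge:
  assumes "prime (p :: nat)" "k > 0"
  shows "p ^ k \<le> 2 * totient (p ^ k)"
proof -
  obtain l where l: "k = Suc l" using assms(2) by (cases k) auto
  have "p \<ge> 2" using assms(1) by (rule prime_ge_2_nat)
  then have "p \<le> 2 * (p - 1)" by linarith
  then have "p ^ l * p \<le> p ^ l * (2 * (p - 1))" by (rule mult_le_mono2)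
  then show ?thesis
    using totient_prime_power_Suc[OF assms(1), of l]
    unfolding l power_Suc2 by (simp only: mult.left_commute)
qed

text \<open>A proper divisor is at most p^(k-1), and the totient is p^(k-1) (p-1). It bounds the
  order of a proper subgroup of a cyclic p-group by the number of generators of the group.\<close>

lemma proper_divisor_le_totient_prime_power:
  assumes "prime (p :: nat)" "b dvd p ^ k" "b \<noteq> p ^ k"
  shows "b \<le> totient (p ^ k)"
proof -
  obtain i where i: "i \<le> k" "b = p ^ i"
    using assms divides_primepow_nat by blast
  then have "i < k" using assms(3) le_neq_implies_less by blast
  then obtain l where l: "k = Suc l" "i \<le> l" by (cases k) auto
  have "p \<ge> 2" using assms(1) by (rule prime_ge_2_nat)
  then have "p ^ i * 1 \<le> p ^ l * (p - 1)"
    using l by (intro mult_le_mono power_increasing) auto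
  then show ?thesis
    using totient_prime_power_Suc[OF assms(1), of l] unfolding i l by simp
qed

lemma divisors_prime_power_comparable:
  fixes a b p :: nat
  assumes "prime p" "a dvd p ^ k" "b dvd p ^ k"
  shows "a dvd b \<or> b dvd a"
proof -
  obtain i j where "a = p ^ i" "b = p ^ j"
    using assms divides_primepow_nat by meson
  then show ?thesis
    using le_imp_power_dvd[of i j p] le_imp_power_dvd[of j i p] nat_le_linear[of i j] by auto
qed

lemma prime_powerI:
  fixes k r :: nat
  assumes "k > 0" "prime r" "\<And>q. prime q \<Longrightarrow> q dvd k \<Longrightarrow> q = r"
  shows "\<exists>s. k = r ^ s"
proof -
  have "\<not> is_unit r" using assms(2) not_prime_unit by blast
  then obtain m where m: "k = r ^ multiplicity r k * m" "\<not> r dvd m"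
    using multiplicity_decompose'[of k r] assms(1) by auto
  have "m = 1"
  proof (rule ccontr)
    assume "m \<noteq> 1"
    then obtain q where "prime q" "q dvd m" using prime_factor_nat by blast
    then show False using assms(3)[of q] m dvd_mult[of q m] by metis
  qed
  then show ?thesis using m by auto
qed

text \<open>Arithmetic model of two twins in a cyclic group of order \<open>k\<close>: divisors
  stand for subgroups and comparability under divisibility for adjacency. The divisor 1 is
  comparable with everything, whence \<open>i > 1\<close>.\<close>

lemma comparable_divisors_imp_prime_power:
  fixes i j k :: nat
  assumes "i dvd j" "j dvd k" "i > 1" "i \<noteq> j" "k > 0"
    and same: "\<And>e. e dvd k \<Longrightarrow> (e dvd j \<or> j dvd e) = (e dvd i \<or> i dvd e)"
  shows "\<exists>p s. prime p \<and> k = p ^ s"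
proof -
  obtain t where t: "j = i * t" using assms(1) by blast
  have "t \<noteq> 1" "j > 0" using t assms by (auto intro: Nat.gr0I)
  then obtain r where r: "prime r" "r dvd t" using prime_factor_nat by blast
  define a where "a = multiplicity r i"
  \<comment> \<open>This prime power divides \<open>j\<close> but not \<open>i\<close>; being
    comparable with \<open>j\<close>, it is comparable with \<open>i\<close>, hence a multiple of
    it. So \<open>i\<close> is a power of \<open>r\<close>.\<close>
  have "r ^ Suc a dvd j"
    using mult_dvd_mono[OF multiplicity_dvd[of r i] r(2)] by (simp add: t a_def mult.commute)
  moreover have "\<not> r ^ Suc a dvd i"
    using assms(3) r(1) unfolding a_def
    by (metis lessI multiplicity_geI not_prime_unit not_less not_one_less_zero)
  ultimately have "i dvd r ^ Suc a" using same assms(2) dvd_trans by blast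
  then obtain b where b: "i = r ^ b" using divides_primepow_nat[OF r(1)] by blast
  with assms(3) have "b > 0" by (cases b) auto
  \<comment> \<open>For another prime \<open>q\<close>, the multiple \<open>i * q\<close> of
    \<open>i\<close> would have to be comparable with \<open>j\<close>, and both directions
    fail.\<close>
  have "q = r" if q: "prime q" "q dvd k" for q
  proof (rule ccontr)
    assume "q \<noteq> r"
    then have cop: "coprime i q" using q r b by (simp add: primes_coprime)
    have "i * q dvd k" using divides_mult[OF dvd_trans[OF assms(1,2)] q(2) cop] .
    then have "i * q dvd j \<or> j dvd i * q" using same by auto
    then show False
    proof
      assume "i * q dvd j"
      then have "q dvd j" by (rule dvd_mult_right)
      then have "q dvd i \<or> i dvd q" using same q by blast
      then show False
        using cop q(1) assms(3) by (auto dest: coprime_common_divisor_nat[of i q])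
    next
      assume "j dvd i * q"
      then have "t dvd q" using t assms(3) by simp
      then have "r dvd q" using r dvd_trans by blast
      then show False using \<open>q \<noteq> r\<close> q r primes_dvd_imp_eq by blast
    qed
  qed
  then show ?thesis using prime_powerI r assms(5) by blast
qed

subsection \<open>Cyclic subgroups of a finite group\<close>

lemma div_dvd_div_iff:
  fixes g h n :: nat
  assumes "g dvd n" "h dvd n" "n > 0"
  shows "n div h dvd n div g \<longleftrightarrow> g dvd h"
proof -
  obtain a b where ab: "n = h * a" "n = g * b" using assms by blast
  then have pos: "a > 0" "b > 0" "g > 0" "h > 0" using assms(3) by (auto intro!: Nat.gr0I)
  have "a dvd b \<longleftrightarrow> g dvd h"
  proof
    assume "a dvd b"
    then obtain c where "b = a * c" by blast
    then have "a * h = a * (g * c)" using ab by (auto simp: mult_ac)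
    then show "g dvd h" using pos by simp
  next
    assume "g dvd h"
    then obtain c where "h = g * c" by blast
    then have "g * (c * a) = g * b" using ab by (auto simp: mult_ac)
    then have "b = c * a" using pos by simp
    then show "a dvd b" by simp
  qed
  moreover have "n div h = a" using ab(1) pos by simp
  moreover have "n div g = b" using ab(2) pos by simp
  ultimately show ?thesis by simp
qed

lemma (in group) pow_eq_iff_cong:
  assumes "x \<in> carrier G"
  shows "x [^] (i::nat) = x [^] (j::nat) \<longleftrightarrow> [i = j] (mod ord x)"
proof -
  have "x [^] i = x [^] j \<longleftrightarrow> x [^] int j = x [^] int i" by (auto simp: int_pow_int)
  also have "\<dots> \<longleftrightarrow> [int i = int j] (mod int (ord x))"
    using assms by (simp add: int_pow_eq cong_iff_dvd_diff)
  finally show ?thesis by (simp add: cong_int_iff)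
qed

lemma (in group) subgroup_nat_pow_closed:
  "subgroup K G \<Longrightarrow> x \<in> K \<Longrightarrow> x [^] (n::nat) \<in> K"
  by (induction n) (auto simp: subgroup.one_closed subgroup.m_closed)

locale finite_group = group G for G (structure) +
  assumes fin [simp, intro]: "finite (carrier G)"
begin

abbreviation cyc :: "'a \<Rightarrow> 'a set" where
  "cyc x \<equiv> generate G {x}"

lemma cyc_iff: "x \<in> carrier G \<Longrightarrow> y \<in> cyc x \<longleftrightarrow> (\<exists>k::nat. y = x [^] k)"
  by (auto simp: generate_pow_on_finite_carrier)

lemma cyc_closed: "x \<in> carrier G \<Longrightarrow> y \<in> cyc x \<Longrightarrow> y \<in> carrier G"
  by (auto simp: cyc_iff)

lemma cyc_self: "x \<in> carrier G \<Longrightarrow> x \<in> cyc x"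
  by (metis cyc_iff nat_pow_eone)

lemma one_in_cyc: "x \<in> carrier G \<Longrightarrow> \<one> \<in> cyc x"
  by (metis cyc_iff nat_pow_0)

lemma cyc_trans: "z \<in> carrier G \<Longrightarrow> y \<in> cyc z \<Longrightarrow> x \<in> cyc y \<Longrightarrow> x \<in> cyc z"
  by (metis cyc_closed cyc_iff nat_pow_pow)

lemma cyc_subgroup: "x \<in> carrier G \<Longrightarrow> subgroup (cyc x) G"
  by (simp add: generate_is_subgroup)

lemma finite_cyc [simp]: "x \<in> carrier G \<Longrightarrow> finite (cyc x)"
  by (rule finite_subset[OF _ fin]) (auto intro: cyc_closed)

lemma card_cyc: "x \<in> carrier G \<Longrightarrow> card (cyc x) = ord x"
  using generate_pow_card by simp

lemma ord_pos: "x \<in> carrier G \<Longrightarrow> ord x > 0"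
  using ord_ge_1[OF fin] by force

lemma pow_in_cyc_iff:
  assumes z: "z \<in> carrier G"
  shows "z [^] i \<in> cyc (z [^] j) \<longleftrightarrow> gcd (ord z) j dvd (i::nat)"
proof
  assume "z [^] i \<in> cyc (z [^] j)"
  then obtain k :: nat where "z [^] i = z [^] (j * k)"
    using z by (auto simp: cyc_iff nat_pow_pow)
  then have "[i = j * k] (mod gcd (ord z) j)"
    using pow_eq_iff_cong[OF z] cong_dvd_modulus_nat gcd_dvd1 by blast
  moreover have "gcd (ord z) j dvd j * k" by simp
  ultimately show "gcd (ord z) j dvd i" using cong_dvd_iff by blast
next
  assume "gcd (ord z) j dvd i"
  then obtain t where t: "i = gcd j (ord z) * t" by (auto simp: gcd.commute)
  obtain a where "[j * a = gcd j (ord z)] (mod ord z)"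
    using cong_solve_nat by blast
  then have "[j * a * t = i] (mod ord z)"
    unfolding t by (rule cong_scalar_right)
  then have "z [^] (j * a * t) = z [^] i"
    using z by (simp add: pow_eq_iff_cong)
  then have "z [^] i = (z [^] j) [^] (a * t)"
    using z by (simp add: nat_pow_pow mult.assoc)
  then show "z [^] i \<in> cyc (z [^] j)"
    using z by (auto simp: cyc_iff)
qed

lemma ord_pow_gcd: "z \<in> carrier G \<Longrightarrow> ord (z [^] (k::nat)) = ord z div gcd (ord z) k"
  using ord_pos[of z] by (simp add: ord_pow_gen)

text \<open>A cyclic group has one subgroup for each divisor of its order. Adjacency inside a cyclic
  group thus becomes comparability of orders.\<close>

lemma in_cyc_iff_ord_dvd:
  assumes z: "z \<in> carrier G" and ab: "a \<in> cyc z" "b \<in> cyc z"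
  shows "a \<in> cyc b \<longleftrightarrow> ord a dvd ord b"
proof -
  obtain i j :: nat where ij: "a = z [^] i" "b = z [^] j"
    using z ab by (auto simp: cyc_iff)
  have "ord a dvd ord b \<longleftrightarrow> gcd (ord z) j dvd gcd (ord z) i"
    using ord_pos[OF z] unfolding ij ord_pow_gcd[OF z] by (intro div_dvd_div_iff) auto
  then show ?thesis
    using z by (simp add: ij pow_in_cyc_iff)
qed

lemma ord_dvd_of_in_cyc: "z \<in> carrier G \<Longrightarrow> a \<in> cyc z \<Longrightarrow> ord a dvd ord z"
  using in_cyc_iff_ord_dvd cyc_self by blast

lemma exists_ord_in_cyc:
  assumes "z \<in> carrier G" "d dvd ord z"
  shows "\<exists>a \<in> cyc z. ord a = d"
proof -
  obtain e where e: "ord z = d * e" using assms(2) by blast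
  then have "e > 0" "d > 0" using assms ord_pos[of z] by auto
  then have "ord (z [^] e) = d"
    using assms e by (simp add: ord_pow)
  moreover have "z [^] e \<in> cyc z" using assms(1) cyc_iff by blast
  ultimately show ?thesis by blast
qed

definition gens :: "'a \<Rightarrow> 'a set" where
  "gens x = {w \<in> carrier G. w \<in> cyc x \<and> x \<in> cyc w}"

lemma card_gens:
  assumes x: "x \<in> carrier G"
  shows "card (gens x) = totient (ord x)"
proof -
  have "gens x = (\<lambda>k. x [^] k) ` totatives (ord x)"
  proof (intro equalityI subsetI)
    fix w assume w: "w \<in> gens x"
    then obtain k :: nat where k: "w = x [^] k" using x by (auto simp: gens_def cyc_iff)
    \<comment> \<open>Totatives are positive and \<open>totatives 1 = {1}\<close>, so in the trivial
      group the residue 0 is replaced by 1.\<close>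
    define l where "l = (if ord x = 1 then 1 else k mod ord x)"
    have "x [^] (1::nat) \<in> cyc (x [^] k)" using w x k by (simp add: gens_def)
    then have "gcd (ord x) k dvd 1" unfolding pow_in_cyc_iff[OF x] .
    then have cop: "coprime (ord x) k" by (simp add: coprime_iff_gcd_eq_1)
    have "w = x [^] l"
      using x k ord_pos[OF x] by (auto simp: l_def pow_eq_iff_cong cong_def)
    moreover have "l \<in> totatives (ord x)"
      using cop ord_pos[OF x]
      by (auto simp: l_def in_totatives_iff coprime_commute intro!: Nat.gr0I)
    ultimately show "w \<in> (\<lambda>k. x [^] k) ` totatives (ord x)" by blast
  next
    fix w assume "w \<in> (\<lambda>k. x [^] k) ` totatives (ord x)"
    then obtain k :: nat where k: "w = x [^] k" "coprime k (ord x)"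
      by (auto simp: in_totatives_iff)
    have "x [^] (1::nat) \<in> cyc (x [^] k)"
      using pow_in_cyc_iff[OF x, of 1 k] k by (simp add: coprime_iff_gcd_eq_1 gcd.commute)
    then show "w \<in> gens x" using x k by (auto simp: gens_def cyc_iff)
  qed
  moreover have "inj_on (\<lambda>k. x [^] k) (totatives (ord x))"
    by (rule inj_on_subset[OF ord_inj'[OF x]]) (auto simp: in_totatives_iff)
  ultimately show ?thesis by (simp add: card_image totient_def)
qed

lemma subgroup_of_cyc:
  assumes z: "z \<in> carrier G" and K: "subgroup K G" "K \<subseteq> cyc z"
  shows "\<exists>w \<in> K. K = cyc w"
proof -
  define P where "P = (\<lambda>i::nat. i > 0 \<and> z [^] i \<in> K)"
  define i where "i = (LEAST i. P i)"
  have "P (ord z)" using z ord_pos subgroup.one_closed[OF K(1)] by (simp add: P_def)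
  then have Pi: "P i" unfolding i_def by (rule LeastI)
  have min: "\<not> P j" if "j < i" for j using that not_less_Least i_def by blast
  let ?w = "z [^] i"
  have w: "?w \<in> K" "?w \<in> carrier G" using Pi z by (auto simp: P_def)
  have "K \<subseteq> cyc ?w"
  proof
    fix v assume v: "v \<in> K"
    then obtain j :: nat where j: "v = z [^] j" using K z cyc_iff by blast
    define q where "q = ?w [^] (j div i)"
    have q: "q \<in> K" "q \<in> carrier G"
      using w subgroup_nat_pow_closed[OF K(1)] by (auto simp: q_def)
    have "v = q \<otimes> z [^] (j mod i)"
      using z by (simp add: j q_def nat_pow_pow nat_pow_mult)
    then have "z [^] (j mod i) = inv q \<otimes> v"
      using z q by (simp add: inv_solve_left)
    then have "z [^] (j mod i) \<in> K"
      using q v K by (simp add: subgroup.m_closed subgroup.m_inv_closed)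
    then have "j mod i = 0" using min[of "j mod i"] Pi by (auto simp: P_def)
    then have "v = q" using \<open>v = q \<otimes> _\<close> q by simp
    then show "v \<in> cyc ?w" using w by (auto simp: cyc_iff q_def)
  qed
  moreover have "cyc ?w \<subseteq> K"
    using w K(1) by (simp add: generate_subgroup_incl)
  ultimately show ?thesis using w by blast
qed

text \<open>The right-hand side depends on \<open>z\<close> only through its order, so cyclic groups
  of equal order, even in different groups, have equally many solutions.\<close>

lemma card_roots_cyc:
  assumes z: "z \<in> carrier G"
  shows "card {v \<in> cyc z. v [^] (m::nat) = \<one>} = card {i. i < ord z \<and> ord z dvd i * m}"
proof -
  have "{v \<in> cyc z. v [^] m = \<one>} = (\<lambda>i. z [^] i) ` {i. i < ord z \<and> ord z dvd i * m}"
  proof (intro equalityI subsetI)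
    fix v assume "v \<in> {v \<in> cyc z. v [^] m = \<one>}"
    then obtain k :: nat where k: "v = z [^] k" "v [^] m = \<one>" using z by (auto simp: cyc_iff)
    have v: "v = z [^] (k mod ord z)"
      using z k by (simp add: pow_eq_iff_cong cong_def)
    then have "ord z dvd (k mod ord z) * m"
      using z k(2) by (simp add: nat_pow_pow pow_eq_id)
    then show "v \<in> (\<lambda>i. z [^] i) ` {i. i < ord z \<and> ord z dvd i * m}"
      using v ord_pos[OF z] by auto
  next
    fix v assume "v \<in> (\<lambda>i. z [^] i) ` {i. i < ord z \<and> ord z dvd i * m}"
    then show "v \<in> {v \<in> cyc z. v [^] m = \<one>}"
      using z by (auto simp: cyc_iff nat_pow_pow pow_eq_id)
  qed
  moreover have "inj_on (\<lambda>i. z [^] i) {i. i < ord z \<and> ord z dvd i * m}"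
    by (rule inj_on_subset[OF ord_inj[OF z]]) auto
  ultimately show ?thesis by (simp add: card_image)
qed

end

subsection \<open>Neighbourhoods in the power graph\<close>

lemma finite_obtains_max:
  fixes h :: "'b \<Rightarrow> nat"
  assumes "finite S" "S \<noteq> {}"
  obtains y where "y \<in> S" "\<And>w. w \<in> S \<Longrightarrow> h w \<le> h y"
proof -
  have "Max (h ` S) \<in> h ` S" using assms by simp
  then obtain y where "y \<in> S" "h y = Max (h ` S)" by auto
  then show ?thesis using that[of y] assms(1) by simp
qed

context finite_group
begin

text \<open>Reflexive, whereas the arcs of \<open>power_graph\<close> omit loops;
  \<open>nbhd\<close> is therefore the closed neighbourhood.\<close>

definition adj :: "'a \<Rightarrow> 'a \<Rightarrow> bool" where
  "adj x y \<longleftrightarrow> x \<in> cyc y \<or> y \<in> cyc x"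

definition nbhd :: "'a \<Rightarrow> 'a set" where
  "nbhd x = {v \<in> carrier G. adj v x}"

text \<open>The identity shares its neighbourhood with every vertex adjacent to all others, although
  it generates a different subgroup. Leaving it out allows twin classes to equal
  \<open>gens\<close>.\<close>

definition twins :: "'a \<Rightarrow> 'a set" where
  "twins x = {w \<in> carrier G. w \<noteq> \<one> \<and> nbhd w = nbhd x}"

definition maximal_cyclic :: "'a \<Rightarrow> bool" where
  "maximal_cyclic x \<longleftrightarrow> x \<in> carrier G \<and> (\<forall>y \<in> carrier G. x \<in> cyc y \<longrightarrow> y \<in> cyc x)"

lemma adj_sym: "adj x y \<longleftrightarrow> adj y x"
  by (auto simp: adj_def)

lemma nbhd_closed: "v \<in> nbhd x \<Longrightarrow> v \<in> carrier G"
  by (simp add: nbhd_def)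

lemma nbhd_sym: "x \<in> carrier G \<Longrightarrow> y \<in> carrier G \<Longrightarrow> x \<in> nbhd y \<longleftrightarrow> y \<in> nbhd x"
  by (auto simp: nbhd_def adj_sym)

lemma finite_nbhd [simp]: "finite (nbhd x)"
  by (rule finite_subset[OF _ fin]) (auto simp: nbhd_def)

lemma finite_twins [simp]: "finite (twins x)"
  by (rule finite_subset[OF _ fin]) (auto simp: twins_def)

lemma finite_gens [simp]: "finite (gens x)"
  by (rule finite_subset[OF _ fin]) (auto simp: gens_def)

lemma self_in_nbhd: "x \<in> carrier G \<Longrightarrow> x \<in> nbhd x"
  by (simp add: nbhd_def adj_def cyc_self)

lemma one_in_nbhd: "x \<in> carrier G \<Longrightarrow> \<one> \<in> nbhd x"
  by (simp add: nbhd_def adj_def one_in_cyc)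

lemma cyc_subset_nbhd: "x \<in> carrier G \<Longrightarrow> cyc x \<subseteq> nbhd x"
  by (auto simp: nbhd_def adj_def intro: cyc_closed)

lemma twins_subset_nbhd: "x \<in> carrier G \<Longrightarrow> twins x \<subseteq> nbhd x"
  using self_in_nbhd by (auto simp: twins_def)

lemma gens_eq_cyc: "x \<in> carrier G \<Longrightarrow> w \<in> gens x \<Longrightarrow> cyc w = cyc x"
  by (auto simp: gens_def intro: cyc_trans)

lemma cyc_one: "cyc \<one> = {\<one>}"
  by (auto simp: cyc_iff)

lemma gens_subset_twins:
  assumes "x \<in> carrier G" "x \<noteq> \<one>"
  shows "gens x \<subseteq> twins x"
proof
  fix w assume w: "w \<in> gens x"
  then have "w \<in> carrier G" "x \<in> cyc w" by (auto simp: gens_def)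
  moreover have "nbhd w = nbhd x"
    using w assms unfolding nbhd_def adj_def gens_def
    by (auto intro: cyc_trans)
  ultimately show "w \<in> twins x" using assms by (auto simp: twins_def cyc_one)
qed

lemma in_nbhd_in_cyc_iff:
  assumes "z \<in> carrier G" "a \<in> cyc z" "b \<in> cyc z"
  shows "a \<in> nbhd b \<longleftrightarrow> ord a dvd ord b \<or> ord b dvd ord a"
  using assms in_cyc_iff_ord_dvd[OF assms] in_cyc_iff_ord_dvd[OF assms(1,3,2)]
  by (auto simp: nbhd_def adj_def intro: cyc_closed)

lemma ord_gt_1: "x \<in> carrier G \<Longrightarrow> x \<noteq> \<one> \<Longrightarrow> ord x > 1"
  using ord_pos[of x] ord_eq_1[of x] by linarith

text \<open>Every divisor of \<open>ord z\<close> is the order of some element of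
  \<open>cyc z\<close>, so equal neighbourhoods of \<open>u\<close> and \<open>w\<close> make their
  orders comparable with the same divisors.\<close>

lemma strict_twins_imp_prime_power:
  assumes z: "z \<in> carrier G" and w: "w \<in> cyc z" and u: "u \<in> cyc w" "u \<noteq> \<one>"
    and neq: "w \<notin> cyc u" and nb: "nbhd u = nbhd w"
  shows "\<exists>p s. prime p \<and> ord z = p ^ s"
proof (rule comparable_divisors_imp_prime_power)
  have uz: "u \<in> cyc z" using z w u(1) by (rule cyc_trans)
  show "ord u dvd ord w" using in_cyc_iff_ord_dvd[OF z uz w] u(1) by simp
  show "ord w dvd ord z" using ord_dvd_of_in_cyc z w by blast
  show "1 < ord u" using ord_gt_1 uz z u(2) cyc_closed by blast
  show "ord u \<noteq> ord w" using in_cyc_iff_ord_dvd[OF z w uz] neq by auto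
  show "ord z > 0" using ord_pos z by blast
  fix e assume "e dvd ord z"
  then obtain a where "a \<in> cyc z" "ord a = e" using exists_ord_in_cyc z by blast
  then show "(e dvd ord w \<or> ord w dvd e) = (e dvd ord u \<or> ord u dvd e)"
    using in_nbhd_in_cyc_iff[OF z _ w, of a] in_nbhd_in_cyc_iff[OF z _ uz, of a] nb by auto
qed

text \<open>Twins are adjacent to each other. If they generated different subgroups, one would lie
  strictly above the other, which \<open>strict_twins_imp_prime_power\<close> excludes.\<close>

lemma twins_eq_gens:
  assumes z: "z \<in> carrier G" "\<nexists>p s. prime p \<and> ord z = p ^ s"
    and y: "y \<in> cyc z" "y \<noteq> \<one>" and sub: "twins y \<subseteq> cyc z"
  shows "twins y = gens y"
proof (intro equalityI subsetI)
  have yc: "y \<in> carrier G" using z y cyc_closed by blast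
  fix a assume a: "a \<in> twins y"
  then have a': "a \<in> carrier G" "a \<noteq> \<one>" "nbhd a = nbhd y" "a \<in> cyc z"
    using sub by (auto simp: twins_def)
  have "a \<in> nbhd y" using a yc twins_subset_nbhd by blast
  then have "a \<in> cyc y \<or> y \<in> cyc a" by (auto simp: nbhd_def adj_def)
  then show "a \<in> gens y"
    using strict_twins_imp_prime_power[OF z(1) y(1), of a]
      strict_twins_imp_prime_power[OF z(1) a'(4), of y] a' y z(2)
    by (auto simp: gens_def)
next
  fix a assume "a \<in> gens y"
  then show "a \<in> twins y" using gens_subset_twins z y cyc_closed by blast
qed

section \<open>Maximal cyclic subgroups\<close>

lemma maximal_nbhd: "maximal_cyclic x \<Longrightarrow> nbhd x = cyc x"
  using cyc_subset_nbhd by (auto simp: maximal_cyclic_def nbhd_def adj_def)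

lemma cyc_eqI_card:
  assumes "y \<in> carrier G" "x \<in> cyc y" "ord y \<le> ord x"
  shows "y \<in> cyc x"
proof -
  have x: "x \<in> carrier G" using assms cyc_closed by blast
  have "cyc x \<subseteq> cyc y" using assms cyc_trans by blast
  then have "cyc x = cyc y"
    using assms x by (intro card_seteq) (auto simp: card_cyc)
  then show ?thesis using assms cyc_self by blast
qed

lemma exists_maximal_cyclic:
  assumes x: "x \<in> carrier G"
  shows "\<exists>y. maximal_cyclic y \<and> x \<in> cyc y"
proof -
  let ?S = "{y \<in> carrier G. x \<in> cyc y}"
  have S: "finite ?S" "?S \<noteq> {}" using x cyc_self by auto
  then obtain y where y: "y \<in> ?S" "\<And>w. w \<in> ?S \<Longrightarrow> ord w \<le> ord y"
    using finite_obtains_max[of ?S ord] by blast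
  have "maximal_cyclic y"
    unfolding maximal_cyclic_def using y cyc_eqI_card cyc_trans by blast
  then show ?thesis using y by blast
qed

lemma maximal_gens: 
  assumes "maximal_cyclic x" "w \<in> gens x"
  shows "maximal_cyclic w"
proof -
  have "x \<in> carrier G" "w \<in> carrier G" "x \<in> cyc w" "w \<in> cyc x"
    using assms by (auto simp: maximal_cyclic_def gens_def)
  then show ?thesis
    using assms(1) unfolding maximal_cyclic_def by (meson cyc_trans)
qed

end

subsection \<open>Isomorphisms of power graphs\<close>

text \<open>Fixing the identity is a normalisation: it makes \<open>f\<close> carry
  \<open>twins\<close>, which leaves out the identity, onto \<open>twins\<close>.\<close>

locale power_graph_iso = G: finite_group G + H: finite_group H
  for G :: "('a, 'm) monoid_scheme" and H :: "('b, 'n) monoid_scheme" +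
  fixes f :: "'a \<Rightarrow> 'b"
  assumes bij: "bij_betw f (carrier G) (carrier H)"
    and adj_iff: "\<And>x y. x \<in> carrier G \<Longrightarrow> y \<in> carrier G \<Longrightarrow> H.adj (f x) (f y) \<longleftrightarrow> G.adj x y"
    and f_one: "f \<one>\<^bsub>G\<^esub> = \<one>\<^bsub>H\<^esub>"
begin

lemma f_closed: "x \<in> carrier G \<Longrightarrow> f x \<in> carrier H"
  using bij bij_betwE by blast

lemma f_inj: "x \<in> carrier G \<Longrightarrow> y \<in> carrier G \<Longrightarrow> f x = f y \<longleftrightarrow> x = y"
  using bij by (auto simp: bij_betw_def inj_on_eq_iff)

lemma f_surj: "y \<in> carrier H \<Longrightarrow> \<exists>x \<in> carrier G. y = f x"
  using bij by (auto simp: bij_betw_def)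

lemma f_in_nbhd_iff: "x \<in> carrier G \<Longrightarrow> y \<in> carrier G \<Longrightarrow> f x \<in> H.nbhd (f y) \<longleftrightarrow> x \<in> G.nbhd y"
  by (simp add: H.nbhd_def G.nbhd_def f_closed adj_iff)

lemma f_nbhd:
  assumes x: "x \<in> carrier G"
  shows "f ` G.nbhd x = H.nbhd (f x)"
proof (intro equalityI subsetI)
  fix v assume "v \<in> H.nbhd (f x)"
  moreover from this obtain u where "u \<in> carrier G" "v = f u"
    using H.nbhd_closed f_surj by blast
  ultimately show "v \<in> f ` G.nbhd x" using x f_in_nbhd_iff by blast
qed (use x f_in_nbhd_iff G.nbhd_closed in blast)

lemma f_image_eq_iff:
  "A \<subseteq> carrier G \<Longrightarrow> B \<subseteq> carrier G \<Longrightarrow> f ` A = f ` B \<longleftrightarrow> A = B"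
  using inj_on_image_eq_iff[OF bij_betw_imp_inj_on[OF bij]] by blast

lemma f_twins:
  assumes x: "x \<in> carrier G"
  shows "f ` G.twins x = H.twins (f x)"
proof -
  have *: "f w \<in> H.twins (f x) \<longleftrightarrow> w \<in> G.twins x" if w: "w \<in> carrier G" for w
  proof -
    have "H.nbhd (f w) = H.nbhd (f x) \<longleftrightarrow> G.nbhd w = G.nbhd x"
      unfolding f_nbhd[OF x, symmetric] f_nbhd[OF w, symmetric]
      by (intro f_image_eq_iff) (auto simp: G.nbhd_def)
    then show ?thesis
      using w f_closed f_inj[of w "\<one>\<^bsub>G\<^esub>"] by (auto simp: H.twins_def G.twins_def f_one)
  qed
  show ?thesis
  proof (intro equalityI subsetI)
    fix v assume v: "v \<in> H.twins (f x)"
    then obtain u where "u \<in> carrier G" "v = f u"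
      using f_surj by (auto simp: H.twins_def)
    then show "v \<in> f ` G.twins x" using v * by blast
  qed (use * in \<open>auto simp: G.twins_def\<close>)
qed

lemma card_image_f: "A \<subseteq> carrier G \<Longrightarrow> card (f ` A) = card A"
  using bij by (meson bij_betw_def card_image inj_on_subset)

lemma card_f_twins: "x \<in> carrier G \<Longrightarrow> card (H.twins (f x)) = card (G.twins x)"
  unfolding f_twins[symmetric] by (rule card_image_f) (auto simp: G.twins_def)

text \<open>A twin class that makes up at least half of a clique neighbourhood forces the latter to be
  a subgroup: otherwise the generators of a larger cyclic group above it are at least as many as
  the twins.\<close>

lemma maximal_image_prime_power:
  assumes max: "G.maximal_cyclic x" and pp: "prime p" "G.ord x = p ^ s" and nt: "x \<noteq> \<one>\<^bsub>G\<^esub>"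
  shows "\<exists>z \<in> carrier H. f ` generate G {x} = generate H {z}"
proof -
  have x: "x \<in> carrier G" using max by (simp add: G.maximal_cyclic_def)
  define y where "y = f x"
  have y: "y \<in> carrier H" "y \<noteq> \<one>\<^bsub>H\<^esub>"
    using x nt f_closed f_inj[of x "\<one>\<^bsub>G\<^esub>"] by (auto simp: y_def f_one)
  have img: "f ` generate G {x} = H.nbhd y"
    using f_nbhd[OF x] G.maximal_nbhd[OF max] by (simp add: y_def)
  \<comment> \<open>The subgroups of a cyclic p-group form a chain, so its elements are pairwise
    adjacent, and so are their images.\<close>
  have clique: "H.adj a b" if "a \<in> H.nbhd y" "b \<in> H.nbhd y" for a b
  proof -
    have "a \<in> f ` generate G {x}" "b \<in> f ` generate G {x}" using that img by simp_all
    then obtain c d where cd: "c \<in> generate G {x}" "d \<in> generate G {x}" "a = f c" "b = f d"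
      by (elim imageE)
    have "G.ord c dvd p ^ s" "G.ord d dvd p ^ s"
      using cd G.ord_dvd_of_in_cyc[OF x] pp by auto
    then have "G.ord c dvd G.ord d \<or> G.ord d dvd G.ord c"
      by (rule divisors_prime_power_comparable[OF pp(1)])
    then show ?thesis
      using G.in_nbhd_in_cyc_iff[OF x cd(1,2)] adj_iff[of c d] cd x G.cyc_closed
      by (auto simp: G.nbhd_def)
  qed
  \<comment> \<open>Adjacent to every member of the clique and of largest order, \<open>z\<close>
    generates all of them. It remains to see that \<open>generate H {z}\<close> is no larger than
    the clique.\<close>
  obtain z where z: "z \<in> H.nbhd y" "\<And>w. w \<in> H.nbhd y \<Longrightarrow> H.ord w \<le> H.ord z"
    using finite_obtains_max[of "H.nbhd y" H.ord] H.self_in_nbhd[OF y(1)] by auto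
  have zc: "z \<in> carrier H" using z H.nbhd_closed by blast
  have sub: "H.nbhd y \<subseteq> generate H {z}"
  proof
    fix w assume w: "w \<in> H.nbhd y"
    then have "w \<in> generate H {z} \<or> z \<in> generate H {w}"
      using clique z(1) by (auto simp: H.adj_def)
    then show "w \<in> generate H {z}"
      using H.cyc_eqI_card[of w z] z(2) w H.nbhd_closed by blast
  qed
  have yz: "y \<in> generate H {z}" using sub H.self_in_nbhd[OF y(1)] by blast
  have "generate H {z} \<subseteq> H.nbhd y"
  proof (cases "z \<in> generate H {y}")
    case True
    then show ?thesis using H.cyc_trans[OF y(1) True] H.cyc_subset_nbhd[OF y(1)] by blast
  next
    case False
    show ?thesis
    proof (cases "\<exists>q k. prime q \<and> H.ord z = q ^ k")
      case True
      then obtain q k where q: "prime q" "H.ord z = q ^ k" by blast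
      show ?thesis
      proof
        fix w assume w: "w \<in> generate H {z}"
        have "H.ord w dvd q ^ k" "H.ord y dvd q ^ k"
          using w yz H.ord_dvd_of_in_cyc[OF zc] q by auto
        then have "H.ord w dvd H.ord y \<or> H.ord y dvd H.ord w"
          by (rule divisors_prime_power_comparable[OF q(1)])
        then show "w \<in> H.nbhd y"
          using H.in_nbhd_in_cyc_iff[OF zc w yz] by simp
      qed
    next
      case npp: False
      have tw: "H.twins y = H.gens y"
        using H.twins_eq_gens[OF zc npp yz y(2)] sub H.twins_subset_nbhd[OF y(1)] by blast
      have dvd: "H.ord y dvd H.ord z" using H.ord_dvd_of_in_cyc zc yz by blast
      have "totient (H.ord y) \<le> totient (H.ord z)"
        using totient_dvd_mono[OF dvd] H.ord_pos[OF zc] by simp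
      then have le: "card (H.twins y) \<le> card (H.gens z)"
        by (simp add: tw H.card_gens y zc)
      have disj: "H.gens y \<inter> H.gens z = {}"
      proof (rule equals0I)
        fix w assume "w \<in> H.gens y \<inter> H.gens z"
        then have "generate H {y} = generate H {z}"
          using H.gens_eq_cyc[OF y(1), of w] H.gens_eq_cyc[OF zc, of w] by simp
        then show False using False H.cyc_self[OF zc] by simp
      qed
      have zn: "z \<noteq> \<one>\<^bsub>H\<^esub>" using False H.one_in_cyc y by blast
      \<comment> \<open>The identity is the extra element that makes the count strict:
        \<open>nbhd y\<close> has more than twice as many elements as \<open>twins y\<close>,
        against the bound for prime powers.\<close>
      have one: "\<one>\<^bsub>H\<^esub> \<notin> H.gens y \<union> H.gens z"
        using y zn by (auto simp: H.gens_def H.cyc_one)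
      have "insert \<one>\<^bsub>H\<^esub> (H.gens y \<union> H.gens z) \<subseteq> H.nbhd y"
        using H.one_in_nbhd[OF y(1)] H.cyc_trans[OF _ _ yz]
        by (auto simp: H.nbhd_def H.adj_def H.gens_def)
      then have "card (insert \<one>\<^bsub>H\<^esub> (H.gens y \<union> H.gens z)) \<le> card (H.nbhd y)"
        by (intro card_mono) auto
      then have "1 + (card (H.gens y) + card (H.gens z)) \<le> card (H.nbhd y)"
        using one disj by (simp add: card_Un_disjoint)
      then have "card (H.nbhd y) > 2 * card (H.twins y)" using le tw by simp
      moreover have "card (H.nbhd y) = p ^ s"
        using img card_image_f[of "generate G {x}"] G.card_cyc[OF x] pp G.cyc_closed x by auto
      moreover have "card (H.twins y) \<ge> totient (p ^ s)"
        using card_f_twins[OF x] card_mono[OF G.finite_twins G.gens_subset_twins[OF x nt]]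
          G.card_gens[OF x] pp by (simp add: y_def)
      moreover have "s > 0" using pp G.ord_gt_1[OF x nt] by (cases s) auto
      ultimately show ?thesis using two_totient_prime_power_ge[OF pp(1), of s] by linarith
    qed
  qed
  then have "f ` generate G {x} = generate H {z}" using img sub by simp
  then show ?thesis using zc by (rule bexI)
qed

text \<open>Choosing \<open>y\<close> to be the top of its twin class, an element strictly above it
  would have too many twins.\<close>

lemma maximal_image_not_prime_power:
  assumes max0: "G.maximal_cyclic x0" and npp: "\<nexists>p s. prime p \<and> G.ord x0 = p ^ s"
  shows "\<exists>z \<in> carrier H. f ` generate G {x0} = generate H {z}"
proof -
  have x0: "x0 \<in> carrier G" using max0 by (simp add: G.maximal_cyclic_def)
  \<comment> \<open>The identity has order 1 = 2^0, which counts as a prime power here.\<close>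
  have "x0 \<noteq> \<one>\<^bsub>G\<^esub>"
    using npp two_is_prime_nat by (metis G.ord_id power_0)
  \<comment> \<open>A twin of \<open>u\<close> is adjacent to \<open>x0\<close> because
    \<open>u\<close> is, and all neighbours of the maximal \<open>x0\<close> lie in its cyclic
    subgroup.\<close>
  have twG: "G.twins u = G.gens u" if u: "u \<in> generate G {x0}" "u \<noteq> \<one>\<^bsub>G\<^esub>" for u
  proof (rule G.twins_eq_gens[OF x0 npp u])
    have uc: "u \<in> carrier G" using u x0 G.cyc_closed by blast
    have "x0 \<in> G.nbhd u" using u x0 by (simp add: G.nbhd_def G.adj_def)
    show "G.twins u \<subseteq> generate G {x0}"
    proof
      fix a assume "a \<in> G.twins u"
      then have "a \<in> carrier G" "x0 \<in> G.nbhd a"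
        using \<open>x0 \<in> G.nbhd u\<close> by (auto simp: G.twins_def)
      then have "a \<in> G.nbhd x0" using G.nbhd_sym x0 by blast
      then show "a \<in> generate G {x0}" using G.maximal_nbhd[OF max0] by simp
    qed
  qed
  have "x0 \<in> G.twins x0" using x0 \<open>x0 \<noteq> _\<close> by (simp add: G.twins_def)
  \<comment> \<open>Its preimage \<open>x\<close> generates the same subgroup as \<open>x0\<close>,
    so the image in question is \<open>nbhd y\<close>, and it suffices that \<open>y\<close> is
    maximal cyclic.\<close>
  then obtain y where y: "y \<in> f ` G.twins x0" "\<And>w. w \<in> f ` G.twins x0 \<Longrightarrow> H.ord w \<le> H.ord y"
    using finite_obtains_max[of "f ` G.twins x0" H.ord] by auto
  then obtain x where xt: "x \<in> G.twins x0" "y = f x" by blast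
  have xg: "x \<in> G.gens x0"
    using xt twG G.cyc_self[OF x0] \<open>x0 \<noteq> _\<close> by simp
  have x: "x \<in> carrier G" "x \<noteq> \<one>\<^bsub>G\<^esub>" "generate G {x} = generate G {x0}"
    using xt xg G.gens_eq_cyc[OF x0] by (auto simp: G.twins_def)
  have max: "G.maximal_cyclic x" using G.maximal_gens max0 xg by blast
  define n where "n = G.ord x"
  have n0: "n > 0" using G.ord_pos x n_def by simp
  have yc: "y \<in> carrier H" "y \<noteq> \<one>\<^bsub>H\<^esub>"
    using x f_closed f_inj[of x "\<one>\<^bsub>G\<^esub>"] xt by (auto simp: f_one)
  have img: "f ` generate G {x0} = H.nbhd y"
    using f_nbhd[OF x(1)] G.maximal_nbhd[OF max] xt x by simp
  have "G.twins x = G.twins x0" using xt by (auto simp: G.twins_def)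
  then have tmax: "H.ord w \<le> H.ord y" if "w \<in> H.twins y" for w
    using y(2) that f_twins[OF x(1)] xt by simp
  have "x \<in> generate G {x0}" using x G.cyc_self by blast
  then have card_y: "card (H.twins y) = totient n"
    using card_f_twins[OF x(1)] twG[of x] x G.card_gens xt n_def by simp

  \<comment> \<open>Were \<open>u\<close> a generator of \<open>generate G {x}\<close>,
    \<open>z\<close> would be a twin of \<open>y\<close> of larger order. The totient bound holds
    since the generators of \<open>z\<close> are twins of \<open>z\<close>, and these correspond to
    the twins of \<open>u\<close>, which are its generators.\<close>
  have above: "\<exists>u. u \<in> generate G {x} \<and> u \<noteq> \<one>\<^bsub>G\<^esub> \<and> z = f u \<and> G.ord u dvd n \<and> G.ord u \<noteq> n
      \<and> totient (H.ord z) \<le> totient (G.ord u)"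
    if z: "z \<in> carrier H" "y \<in> generate H {z}" "z \<notin> generate H {y}" for z
  proof -
    have "z \<in> H.nbhd y" using z by (simp add: H.nbhd_def H.adj_def)
    then obtain u where u: "u \<in> generate G {x}" "z = f u" using img x by auto
    have uc: "u \<in> carrier G" using u x G.cyc_closed by blast
    have zn: "z \<noteq> \<one>\<^bsub>H\<^esub>" using z yc H.one_in_cyc by blast
    have un: "u \<noteq> \<one>\<^bsub>G\<^esub>" using zn u f_one by auto
    have "G.ord u \<noteq> n"
    proof
      assume "G.ord u = n"
      then have "x \<in> generate G {u}"
        using G.in_cyc_iff_ord_dvd[OF x(1) G.cyc_self[OF x(1)] u(1)] n_def by simp
      then have "u \<in> G.gens x" using u uc by (simp add: G.gens_def)
      then have "u \<in> G.twins x" using G.gens_subset_twins x by blast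
      then have "z \<in> H.twins y" using f_twins[OF x(1)] xt u by blast
      then have "H.ord z \<le> H.ord y" using tmax by blast
      then show False using z H.cyc_eqI_card by blast
    qed
    moreover have "totient (H.ord z) \<le> totient (G.ord u)"
      using card_mono[OF H.finite_twins H.gens_subset_twins[OF z(1) zn]]
        H.card_gens[OF z(1)] card_f_twins[OF uc] twG[of u] u un x G.card_gens[OF uc]
      by simp
    moreover have "G.ord u dvd n" using G.ord_dvd_of_in_cyc u x n_def by blast
    ultimately show ?thesis using u un by blast
  qed

  have "z \<in> generate H {y}" if z: "z \<in> carrier H" "y \<in> generate H {z}" for z
  proof (rule ccontr)
    assume zy: "z \<notin> generate H {y}"
    obtain u where u: "u \<in> generate G {x}" "u \<noteq> \<one>\<^bsub>G\<^esub>" "z = f u" "G.ord u dvd n"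
      "G.ord u \<noteq> n" "totient (H.ord z) \<le> totient (G.ord u)"
      using above z zy by blast
    have uc: "u \<in> carrier G" using u x G.cyc_closed by blast
    have u_le: "totient (G.ord u) \<le> totient n"
      using totient_dvd_mono[OF u(4)] n0 by simp
    have dvd: "H.ord y dvd H.ord z" using H.ord_dvd_of_in_cyc z by blast
    have y_le: "totient (H.ord y) \<le> totient (H.ord z)"
      using totient_dvd_mono[OF dvd] H.ord_pos[OF z(1)] by simp
    show False
    proof (cases "H.twins y = H.gens y")
      case True
      then have eq: "totient n = totient (H.ord y)" using card_y H.card_gens[OF yc(1)] by simp
      \<comment> \<open>The chain phi(n) = phi(ord y) <= phi(ord z) <= phi(ord u) <= phi(n)
        collapses to equalities.\<close>
      have half: "n = 2 * G.ord u" "odd (G.ord u)"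
        using totient_eq_dvd_cases[OF u(4) n0] u(5) u_le u(6) y_le eq by auto
      \<comment> \<open>The involution \<open>w\<close> is not adjacent to \<open>u\<close>, whose
        order is odd and greater than 1. Yet \<open>f w\<close> is adjacent to \<open>y\<close>: if
        it lies below \<open>y\<close>, it lies below \<open>z = f u\<close>; if strictly above,
        \<open>above\<close> applies to it and leaves only n = 2 or n = 4.\<close>
      obtain w where w: "w \<in> generate G {x}" "G.ord w = 2"
        using G.exists_ord_in_cyc[OF x(1), of 2] half n_def by auto
      have wc: "w \<in> carrier G" using w x G.cyc_closed by blast
      have "G.ord u > 1" using G.ord_gt_1 uc u by blast
      have "\<not> G.ord u dvd 2"
      proof
        assume "G.ord u dvd 2"
        then have "G.ord u \<le> 2" by (simp add: dvd_imp_le)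
        then have "G.ord u = 2" using \<open>G.ord u > 1\<close> by linarith
        then show False using half(2) by simp
      qed
      then have nadj: "w \<notin> G.nbhd u"
        using G.in_nbhd_in_cyc_iff[OF x(1) w(1) u(1)] half(2) w(2) by simp
      have "f w \<in> H.nbhd y" using w img x by blast
      then consider "f w \<in> generate H {y}" | "f w \<notin> generate H {y}" "y \<in> generate H {f w}"
        by (auto simp: H.nbhd_def H.adj_def)
      then show False
      proof cases
        case 1
        then have "f w \<in> generate H {z}" using H.cyc_trans z by blast
        then have "f w \<in> H.nbhd z" using f_closed wc by (simp add: H.nbhd_def H.adj_def)
        then show False using nadj f_in_nbhd_iff wc uc u by blast
      next
        case 2
        then obtain w' where w': "w' \<in> generate G {x}" "f w = f w'" "G.ord w' dvd n"
          "G.ord w' \<noteq> n" "totient (H.ord (f w)) \<le> totient (G.ord w')"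
          using above[of "f w"] f_closed wc by blast
        then have "w' = w" using f_inj wc x G.cyc_closed by blast
        have "H.ord y dvd H.ord (f w)" using H.ord_dvd_of_in_cyc f_closed wc 2 by blast
        then have "totient (H.ord y) \<le> totient (H.ord (f w))"
          using totient_dvd_mono[OF _ H.ord_pos[OF f_closed[OF wc]]] by simp
        have ow: "G.ord w' = 2" using \<open>w' = w\<close> w(2) by simp
        have "totient n \<le> totient 2"
          using \<open>totient (H.ord y) \<le> totient (H.ord (f w))\<close> w'(5) unfolding eq ow by linarith
        moreover have "totient 2 \<le> totient n" using totient_dvd_mono[OF w'(3) n0] unfolding ow .
        ultimately have "2 = n \<or> n = 2 * 2"
          using totient_eq_dvd_cases[OF w'(3) n0] unfolding ow by linarith
        then show False using half \<open>G.ord u > 1\<close> by auto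
      qed
    next
      case False
      then obtain y' where y': "y' \<in> H.twins y" "y' \<notin> H.gens y"
        using H.gens_subset_twins[OF yc] by blast
      then have y'c: "y' \<in> carrier H" "y' \<noteq> \<one>\<^bsub>H\<^esub>" "H.nbhd y' = H.nbhd y"
        by (auto simp: H.twins_def)
      have below: "w \<in> generate H {y}" if "w \<in> H.twins y" for w
      proof -
        have "w \<in> H.nbhd y" "w \<in> carrier H"
          using that H.twins_subset_nbhd[OF yc(1)] by (auto simp: H.twins_def)
        then show ?thesis
          using tmax[OF that] H.cyc_eqI_card[of w y] by (auto simp: H.nbhd_def H.adj_def)
      qed
      \<comment> \<open>All twins of \<open>y\<close> lie in its cyclic subgroup, so a twin that is
        not a generator lies strictly below it; this makes \<open>H.ord z\<close> a prime
        power.\<close>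
      then have y'y: "y' \<in> generate H {y}" "y \<notin> generate H {y'}"
        using y' y'c by (auto simp: H.gens_def)
      then obtain q k where q: "prime q" "H.ord z = q ^ k"
        using H.strict_twins_imp_prime_power[OF z y'y(1) y'c(2) y'y(2) y'c(3)] by blast
      have "H.ord y \<noteq> H.ord z"
        using H.cyc_eqI_card[OF z] zy by auto
      then have "H.ord y \<le> totient (H.ord z)"
        using proper_divisor_le_totient_prime_power[OF q(1), of "H.ord y" k] dvd q by simp
      \<comment> \<open>Strict because of the identity. The contradiction is ord y <= phi(ord z) <=
        phi(n) = |twins y| < ord y.\<close>
      moreover have "H.twins y \<subset> generate H {y}"
        using below H.one_in_cyc[OF yc(1)] by (auto simp: H.twins_def)
      then have "card (H.twins y) < H.ord y"
        using psubset_card_mono[OF H.finite_cyc[OF yc(1)]] H.card_cyc[OF yc(1)] by simp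
      ultimately show False using u(6) u_le card_y by simp
    qed
  qed
  then have "H.maximal_cyclic y" using yc by (simp add: H.maximal_cyclic_def)
  then show ?thesis using img H.maximal_nbhd yc by auto
qed

lemma maximal_image:
  assumes "G.maximal_cyclic x"
  shows "\<exists>z \<in> carrier H. f ` generate G {x} = generate H {z}"
proof (cases "x = \<one>\<^bsub>G\<^esub>")
  case True
  then show ?thesis using G.cyc_one H.cyc_one f_one by (intro bexI[of _ "\<one>\<^bsub>H\<^esub>"]) auto
next
  case False
  then show ?thesis
    using assms maximal_image_prime_power maximal_image_not_prime_power by metis
qed

end

subsection \<open>Counting the solutions of \<open>x\<^sup>m = 1\<close>\<close>

text \<open>Counting only the elements of a fixed set \<open>R\<close> is additive too; with
  \<open>R\<close> the set of solutions, inclusion-exclusion counts solutions.\<close>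

lemma Incl_Excl_card_Int: "Incl_Excl finite (\<lambda>S. int (card (S \<inter> R)))"
proof
  fix S T :: "'a set"
  assume "finite S" "finite T" "disjnt S T"
  then have "card (S \<inter> R \<union> T \<inter> R) = card (S \<inter> R) + card (T \<inter> R)"
    by (intro card_Un_disjoint) (auto simp: disjnt_def)
  then show "int (card ((S \<union> T) \<inter> R)) = int (card (S \<inter> R)) + int (card (T \<inter> R))"
    by (simp add: Int_Un_distrib2)
qed auto

context power_graph_iso
begin

lemma card_roots_eq:
  "card {x \<in> carrier G. x [^]\<^bsub>G\<^esub> (m::nat) = \<one>\<^bsub>G\<^esub>} = card {x \<in> carrier H. x [^]\<^bsub>H\<^esub> m = \<one>\<^bsub>H\<^esub>}"
proof -
  define A where "A = {x. G.maximal_cyclic x}"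
  define RG where "RG = {x. x [^]\<^bsub>G\<^esub> m = \<one>\<^bsub>G\<^esub>}"
  define RH where "RH = {x. x [^]\<^bsub>H\<^esub> m = \<one>\<^bsub>H\<^esub>}"
  have A: "A \<subseteq> carrier G" by (auto simp: A_def G.maximal_cyclic_def)
  have finA: "finite A" using A finite_subset by blast
  interpret IG: Incl_Excl finite "\<lambda>S. int (card (S \<inter> RG))"
    by (rule Incl_Excl_card_Int)
  interpret IH: Incl_Excl finite "\<lambda>S. int (card (S \<inter> RH))"
    by (rule Incl_Excl_card_Int)
  have covG: "(\<Union>x\<in>A. generate G {x}) = carrier G"
    using A G.exists_maximal_cyclic G.cyc_closed by (auto simp: A_def)
  then have covH: "(\<Union>x\<in>A. f ` generate G {x}) = carrier H"
    using bij by (metis bij_betw_def image_UN)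
  \<comment> \<open>Both intersections are subgroups of a cyclic group, hence cyclic, and
    \<open>f\<close> maps one bijectively onto the other. Equal orders give equally many solutions
    by \<open>card_roots_cyc\<close>. The empty \<open>B\<close> is absent from the
    inclusion-exclusion sum.\<close>
  have inter: "card ((\<Inter>x\<in>B. generate G {x}) \<inter> RG) = card ((\<Inter>x\<in>B. f ` generate G {x}) \<inter> RH)"
    if B: "B \<subseteq> A" "B \<noteq> {}" for B
  proof -
    obtain b where b: "b \<in> B" using B by blast
    then have bc: "b \<in> carrier G" using A B by blast
    have cyc: "\<exists>z \<in> carrier H. f ` generate G {x} = generate H {z}" if "x \<in> B" for x
      using that B maximal_image by (auto simp: A_def)
    have "subgroup (\<Inter>x\<in>B. generate G {x}) G"
      using b B A by (intro G.subgroups_Inter) (auto intro: G.cyc_subgroup)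
    then have "\<exists>w \<in> (\<Inter>x\<in>B. generate G {x}). (\<Inter>x\<in>B. generate G {x}) = generate G {w}"
      by (rule G.subgroup_of_cyc[OF bc]) (rule INT_lower[OF b])
    then obtain w where w: "w \<in> generate G {b}" "(\<Inter>x\<in>B. generate G {x}) = generate G {w}"
      using b by (elim bexE) (erule INT_E[of _ _ _ b], auto)
    have wc: "w \<in> carrier G" using G.cyc_closed[OF bc w(1)] .
    obtain z where z: "z \<in> carrier H" "f ` generate G {b} = generate H {z}" using cyc b by blast
    have "subgroup (\<Inter>x\<in>B. f ` generate G {x}) H"
      using b cyc H.cyc_subgroup by (intro H.subgroups_Inter) fastforce+
    then have "\<exists>v \<in> (\<Inter>x\<in>B. f ` generate G {x}). (\<Inter>x\<in>B. f ` generate G {x}) = generate H {v}"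
      by (rule H.subgroup_of_cyc[OF z(1)]) (use INT_lower[OF b, of "\<lambda>x. f ` generate G {x}"] z in simp)
    then obtain v where v: "v \<in> generate H {z}" "(\<Inter>x\<in>B. f ` generate G {x}) = generate H {v}"
      using b z(2) by (elim bexE) (erule INT_E[of _ _ _ b], auto)
    have vc: "v \<in> carrier H" using H.cyc_closed[OF z(1) v(1)] .
    have "generate G {x} \<subseteq> carrier G" if "x \<in> B" for x
      using that A B G.cyc_closed by blast
    then have "f ` (\<Inter>x\<in>B. generate G {x}) = (\<Inter>x\<in>B. f ` generate G {x})"
      using b by (intro image_INT[OF bij_betw_imp_inj_on[OF bij]]) auto
    then have "f ` generate G {w} = generate H {v}" unfolding w(2) v(2) .
    moreover have "generate G {w} \<subseteq> carrier G" using G.cyc_closed[OF wc] by blast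
    ultimately have "card (generate G {w}) = card (generate H {v})"
      using card_image_f by metis
    then have "G.ord w = H.ord v" using wc vc by (simp add: G.card_cyc H.card_cyc)
    then show ?thesis
      using G.card_roots_cyc[OF wc, of m] H.card_roots_cyc[OF vc, of m]
      by (simp add: w(2) v(2) RG_def RH_def Int_def)
  qed
  have fc: "finite (generate G {x})" if "x \<in> A" for x using that A G.finite_cyc by blast
  have "int (card (carrier G \<inter> RG)) =
      (\<Sum>B | B \<subseteq> A \<and> B \<noteq> {}. (- 1) ^ (card B + 1) * int (card ((\<Inter>x\<in>B. generate G {x}) \<inter> RG)))"
    using IG.restricted_indexed[OF finA, of "\<lambda>x. generate G {x}"] fc unfolding covG by blast
  also have "\<dots> =
      (\<Sum>B | B \<subseteq> A \<and> B \<noteq> {}. (- 1) ^ (card B + 1) * int (card ((\<Inter>x\<in>B. f ` generate G {x}) \<inter> RH)))"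
    by (intro sum.cong refl) (simp add: inter)
  also have "\<dots> = int (card (carrier H \<inter> RH))"
    using IH.restricted_indexed[OF finA, of "\<lambda>x. f ` generate G {x}"] fc unfolding covH by simp
  finally show ?thesis by (simp add: RG_def RH_def Int_def)
qed

end

section \<open>From digraph isomorphisms to adjacency-preserving maps fixing the identity\<close>

lemma pair_wf_digraph_power_graph: "pair_wf_digraph (power_graph G)"
  by unfold_locales (auto simp: power_graph_def)

lemma (in finite_group) power_graph_arc_iff:
  assumes "a \<in> carrier G" "b \<in> carrier G"
  shows "(a, b) \<in> parcs (power_graph G) \<longleftrightarrow> a \<noteq> b \<and> adj a b"
proof -
  have "x \<in> cyc y \<longleftrightarrow> (\<exists>k::nat. k > 0 \<and> y [^] k = x)" if y: "y \<in> carrier G" for x y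
  proof
    assume "x \<in> cyc y"
    then obtain k :: nat where "x = y [^] k" using cyc_iff y by blast
    \<comment> \<open>\<open>cyc_iff\<close> admits the exponent 0 while arcs require a positive
      one; adding the order repairs this.\<close>
    then have "y [^] (k + ord y) = x" using y by (simp flip: nat_pow_mult)
    then show "\<exists>k::nat. k > 0 \<and> y [^] k = x" using ord_pos[OF y] by (intro exI[of _ "k + ord y"]) simp
  qed (use cyc_iff y in blast)
  then show ?thesis using assms by (auto simp: power_graph_def adj_def)
qed

lemma card_roots_eq_of_power_graph_iso:
  fixes G :: "('a, 'm) monoid_scheme" and H :: "('b, 'n) monoid_scheme" and m :: nat
  assumes "finite_group G" "finite_group H"
    and iso: "digraph_iso (with_proj (power_graph G)) (with_proj (power_graph H))"
  shows "card {x \<in> carrier G. x [^]\<^bsub>G\<^esub> m = \<one>\<^bsub>G\<^esub>} = card {x \<in> carrier H. x [^]\<^bsub>H\<^esub> m = \<one>\<^bsub>H\<^esub>}"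
    and "order G = order H"
proof -
  interpret G: finite_group G by fact
  interpret H: finite_group H by fact
  have [simp]: "pverts (power_graph G) = carrier G" "pverts (power_graph H) = carrier H"
    by (auto simp: power_graph_def)
  obtain g where bij: "bij_betw g (carrier G) (carrier H)"
    and arcs: "\<And>a b. a \<in> carrier G \<Longrightarrow> b \<in> carrier G \<Longrightarrow>
      (a, b) \<in> parcs (power_graph G) \<longleftrightarrow> (g a, g b) \<in> parcs (power_graph H)"
    using iso unfolding digraph_iso_with_proj_iff[OF pair_wf_digraph_power_graph pair_wf_digraph_power_graph]
    by auto
  have gc: "g x \<in> carrier H" if "x \<in> carrier G" for x using that bij bij_betwE by blast
  have adj: "H.adj (g a) (g b) \<longleftrightarrow> G.adj a b" if "a \<in> carrier G" "b \<in> carrier G" for a b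
  proof (cases "a = b")
    case True
    then show ?thesis using that gc G.cyc_self H.cyc_self by (auto simp: G.adj_def H.adj_def)
  next
    case False
    then have "g a \<noteq> g b" using that bij by (auto simp: bij_betw_def inj_on_eq_iff)
    then show ?thesis
      using arcs[OF that] False that gc by (simp add: G.power_graph_arc_iff H.power_graph_arc_iff)
  qed
  text \<open>The image of the identity is adjacent to everything, so it may be swapped with the identity.\<close>
  define c where "c = g \<one>\<^bsub>G\<^esub>"
  define t where "t = transpose c \<one>\<^bsub>H\<^esub>"
  have cc: "c \<in> carrier H" using gc by (simp add: c_def)
  have dom: "H.adj u v" "H.adj v u" if "u = c \<or> u = \<one>\<^bsub>H\<^esub>" "v \<in> carrier H" for u v
  proof -
    obtain w where w: "w \<in> carrier G" "v = g w" using bij \<open>v \<in> _\<close> by (auto simp: bij_betw_def)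
    have "H.adj c v" using adj[of "\<one>\<^bsub>G\<^esub>" w] w G.one_in_cyc by (simp add: c_def G.adj_def)
    moreover have "H.adj \<one>\<^bsub>H\<^esub> v" using that H.one_in_cyc by (simp add: H.adj_def)
    ultimately show "H.adj u v" "H.adj v u" using that(1) H.adj_sym by blast+
  qed
  have tc: "t u \<in> carrier H" if "u \<in> carrier H" for u
    using that cc by (auto simp: t_def transpose_def)
  have tadj: "H.adj (t u) (t v) \<longleftrightarrow> H.adj u v" if uv: "u \<in> carrier H" "v \<in> carrier H" for u v
  proof (cases "u = c \<or> u = \<one>\<^bsub>H\<^esub> \<or> v = c \<or> v = \<one>\<^bsub>H\<^esub>")
    case True
    then have "t u = c \<or> t u = \<one>\<^bsub>H\<^esub> \<or> t v = c \<or> t v = \<one>\<^bsub>H\<^esub>" by (auto simp: t_def)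
    then show ?thesis using True dom uv tc by blast
  next
    case False
    then show ?thesis by (simp add: t_def)
  qed
  have "bij_betw t (carrier H) (carrier H)"
    using cc by (simp add: t_def bij_betw_transpose_iff)
  then interpret power_graph_iso G H "t \<circ> g"
    using bij adj tadj gc
    by unfold_locales (auto intro: bij_betw_trans simp: t_def c_def)
  show "card {x \<in> carrier G. x [^]\<^bsub>G\<^esub> m = \<one>\<^bsub>G\<^esub>} = card {x \<in> carrier H. x [^]\<^bsub>H\<^esub> m = \<one>\<^bsub>H\<^esub>}"
    by (rule card_roots_eq)
  show "order G = order H" using bij by (simp add: order_def bij_betw_same_card)
qed

subsection \<open>Quotients and coprime orders\<close>

context group
begin

lemma pow_conj:
  assumes "g \<in> carrier G" "x \<in> carrier G"
  shows "(g \<otimes> x \<otimes> inv g) [^] (k::nat) = g \<otimes> x [^] k \<otimes> inv g"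
proof (induction k)
  case (Suc k)
  have "inv g \<otimes> (g \<otimes> (x \<otimes> inv g)) = x \<otimes> inv g"
    using assms by (simp add: m_assoc[symmetric])
  then show ?case using Suc assms by (simp add: m_assoc)
qed (use assms in simp)

lemma eq_one_of_coprime_pows:
  assumes "x \<in> carrier G" "x [^] (a::nat) = \<one>" "x [^] b = \<one>" "coprime a b"
  shows "x = \<one>"
proof -
  have "ord x dvd a" "ord x dvd b" using assms pow_eq_id by auto
  then have "ord x = 1" using assms(4) coprime_common_divisor_nat by blast
  then show ?thesis using assms ord_eq_1 by blast
qed

lemma subgroup_pow_card:
  assumes "subgroup N G" "x \<in> N"
  shows "x [^] card N = \<one>"
proof -
  interpret N: group "G\<lparr>carrier := N\<rparr>" using assms(1) by (rule subgroup_imp_group)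
  show ?thesis
    using N.pow_order_eq_1[of x] assms(2) by (simp add: order_def nat_pow_consistent[symmetric])
qed

text \<open>A common prime p of \<open>card N\<close> and \<open>q\<close> would give, by Sylow, a
  subgroup of order p; its nontrivial elements would be killed by both p and \<open>k\<close>, which
  are coprime.\<close>

lemma coprime_card_of_exponent:
  assumes N: "subgroup N G" "finite N" and exp: "\<And>x. x \<in> N \<Longrightarrow> x [^] (k::nat) = \<one>"
    and "coprime k q"
  shows "coprime (card N) q"
proof (rule ccontr)
  interpret N: group "G\<lparr>carrier := N\<rparr>" using N(1) by (rule subgroup_imp_group)
  assume "\<not> coprime (card N) q"
  then have "gcd (card N) q \<noteq> 1" by (simp add: coprime_iff_gcd_eq_1)
  then obtain p where p: "prime p" "p dvd gcd (card N) q" using prime_factor_nat by blast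
  then have "p dvd card N" "p dvd q" by auto
  then obtain t where t: "order (G\<lparr>carrier := N\<rparr>) = p ^ 1 * t" by (auto simp: order_def)
  obtain P where P: "subgroup P (G\<lparr>carrier := N\<rparr>)" "card P = p ^ 1"
    using sylow_thm[OF p(1) N.is_group t] N(2) by auto
  have PG: "subgroup P G" using incl_subgroup[OF N(1) P(1)] .
  have "\<exists>x \<in> P. x \<noteq> \<one>"
  proof (rule ccontr)
    assume "\<not> ?thesis"
    then have "P \<subseteq> {\<one>}" by auto
    then have "card P \<le> 1" using card_mono[of "{\<one>}" P] by simp
    then show False using P(2) prime_gt_1_nat[OF p(1)] by simp
  qed
  then obtain x where x: "x \<in> P" "x \<noteq> \<one>" by blast
  have "x \<in> N" using x subgroup.subset[OF P(1)] by auto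
  have "coprime k p" using \<open>coprime k q\<close> \<open>p dvd q\<close> by (meson coprime_divisors dvd_refl)
  moreover have "x [^] k = \<one>" using exp \<open>x \<in> N\<close> by simp
  moreover have "x [^] p = \<one>" using subgroup_pow_card[OF PG x(1)] P(2) by simp
  ultimately show False
    using eq_one_of_coprime_pows x subgroup.mem_carrier[OF PG] by blast
qed

text \<open>The last nontrivial term of the derived series is abelian, since its commutators vanish,
  and normal like all its terms.\<close>

lemma solvable_imp_abelian_normal:
  assumes "solvable G" "carrier G \<noteq> {\<one>}"
  shows "\<exists>A. A \<lhd> G \<and> A \<noteq> {\<one>} \<and> (\<forall>a\<in>A. \<forall>b\<in>A. a \<otimes> b = b \<otimes> a)"
proof -
  define D where "D = (\<lambda>n. (derived G ^^ n) (carrier G))"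
  define n where "n = (LEAST n. D n = {\<one>})"
  have "\<exists>n. D n = {\<one>}" using assms(1) solvable_iff_trivial_derived_seq by (simp add: D_def)
  then have Dn: "D n = {\<one>}" unfolding n_def by (rule LeastI_ex)
  have "n \<noteq> 0"
  proof
    assume "n = 0"
    then show False using Dn assms(2) by (simp add: D_def)
  qed
  then obtain k where k: "n = Suc k" by (cases n) auto
  have Dk: "D k \<noteq> {\<one>}" using not_less_Least[of k "\<lambda>n. D n = {\<one>}"] k n_def by auto
  have normal: "D k \<lhd> G"
  proof (induction k)
    case 0
    show ?case using normal_self by (simp add: D_def)
  next
    case (Suc k)
    then show ?case using derived_is_normal by (simp add: D_def)
  qed
  have sub: "D k \<subseteq> carrier G" using normal normal_imp_subgroup subgroup.subset by blast
  have "a \<otimes> b = b \<otimes> a" if ab: "a \<in> D k" "b \<in> D k" for a b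
  proof -
    have c: "a \<in> carrier G" "b \<in> carrier G" using ab sub by auto
    have "a \<otimes> b \<otimes> inv a \<otimes> inv b \<in> derived G (D k)"
      unfolding derived_def using ab by (intro generate.incl) auto
    then have "a \<otimes> b \<otimes> inv a \<otimes> inv b = \<one>" using Dn k by (simp add: D_def)
    then have "a \<otimes> b \<otimes> inv a = b" using c inv_equality[of "a \<otimes> b \<otimes> inv a" "inv b"] by simp
    then show ?thesis using c by (metis inv_solve_right m_closed)
  qed
  then show ?thesis using normal Dk by blast
qed

end

section \<open>Preimages under surjective homomorphisms and quotients\<close>

lemma (in group_hom) card_vimage_surj:
  assumes surj: "h ` carrier G = carrier H" and fin: "finite (carrier G)" and S: "S \<subseteq> carrier H"
  shows "card {x \<in> carrier G. h x \<in> S} = card S * card (kernel G H h)"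
proof -
  let ?F = "\<lambda>s. {x \<in> carrier G. h x = s}"
  have fib: "card (?F s) = card (kernel G H h)" if "s \<in> S" for s
  proof -
    have "s \<in> h ` carrier G" unfolding surj using that S by blast
    then obtain g where g: "g \<in> carrier G" "s = h g" by blast
    have "?F s = (\<lambda>x. x \<otimes> g) ` kernel G H h"
    proof (intro equalityI subsetI)
      fix x assume x: "x \<in> ?F s"
      then have "x = (x \<otimes> inv g) \<otimes> g" using g by (simp add: G.m_assoc)
      moreover have "x \<otimes> inv g \<in> kernel G H h" using x g by (simp add: kernel_def)
      ultimately show "x \<in> (\<lambda>x. x \<otimes> g) ` kernel G H h" by blast
    next
      fix x assume "x \<in> (\<lambda>x. x \<otimes> g) ` kernel G H h"
      then show "x \<in> ?F s" using g by (auto simp: kernel_def)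
    qed
    moreover have "inj_on (\<lambda>x. x \<otimes> g) (kernel G H h)"
      using g by (auto simp: inj_on_def kernel_def)
    ultimately show ?thesis by (simp add: card_image)
  qed
  have finS: "finite S" using finite_subset[OF S] surj fin by (metis finite_imageI)
  have "{x \<in> carrier G. h x \<in> S} = (\<Union>s\<in>S. ?F s)" by auto
  also have "card \<dots> = (\<Sum>s\<in>S. card (?F s))"
    using fin finS by (intro card_UN_disjoint) auto
  finally show ?thesis using fib by simp
qed

lemma (in group_hom) normal_vimage:
  assumes "K \<lhd> H"
  shows "{x \<in> carrier G. h x \<in> K} \<lhd> G"
proof (rule G.normal_invI)
  have K: "subgroup K H" using assms by (rule normal_imp_subgroup)
  show "subgroup {x \<in> carrier G. h x \<in> K} G"
  proof (rule G.subgroupI)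
    have "\<one> \<in> {x \<in> carrier G. h x \<in> K}" using subgroup.one_closed[OF K] by simp
    then show "{x \<in> carrier G. h x \<in> K} \<noteq> {}" by blast
  qed (use K in \<open>auto simp: subgroup.m_inv_closed subgroup.m_closed\<close>)
  fix x k assume "x \<in> carrier G" "k \<in> {x \<in> carrier G. h x \<in> K}"
  then show "x \<otimes> k \<otimes> inv x \<in> {x \<in> carrier G. h x \<in> K}"
    using normal.inv_op_closed2[OF assms, of "h x" "h k"] by simp
qed

text \<open>The factor group consists of sets of elements; being finite, it is copied into the
  natural numbers, so that repeated quotients keep one type.\<close>

lemma (in finite_group) obtains_nat_quotient:
  assumes N: "N \<lhd> G"
  obtains G' :: "nat monoid" and h where "finite_group G'" "group_hom G G' h"
    "h ` carrier G = carrier G'" "kernel G G' h = N"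
proof -
  interpret N: normal N G by fact
  let ?Q = "G Mod N"
  have Q: "group ?Q" by (rule N.factorgroup_is_group)
  have finQ: "finite (carrier ?Q)" by (simp add: carrier_FactGroup)
  obtain e :: "'a set \<Rightarrow> nat" where e: "inj_on e (carrier ?Q)"
    using finite_imp_inj_to_nat_seg[OF finQ] by blast
  let ?G' = "image_group e ?Q"
  have grp: "group ?G'" using group.inj_imp_image_group_is_group[OF Q e] .
  have ehom: "e \<in> hom ?Q ?G'" using inj_imp_image_group_iso[OF e] by (simp add: iso_def)
  define h where "h = e \<circ> (\<lambda>x. N #> x)"
  have hom: "h \<in> hom G ?G'"
    unfolding h_def using N.r_coset_hom_Mod ehom by (rule Group.hom_compose)
  have "finite_group ?G'"
    using grp finQ by (simp add: finite_group_def finite_group_axioms_def image_group_carrier)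
  moreover have gh: "group_hom G ?G' h"
    using hom grp is_group by (simp add: group_hom_def group_hom_axioms_def)
  moreover have "h ` carrier G = carrier ?G'"
    by (simp add: h_def image_group_carrier carrier_FactGroup image_comp)
  moreover have "kernel G ?G' h = N"
  proof (intro equalityI subsetI)
    fix x assume "x \<in> kernel G ?G' h"
    then have x: "x \<in> carrier G" "e (N #> x) = e N"
      by (auto simp: kernel_def h_def image_group_one)
    have "N #> x \<in> carrier ?Q" "N \<in> carrier ?Q"
      using x N.subgroup_in_rcosets[OF is_group] by (auto simp: FactGroup_def RCOSETS_def)
    then have "N #> x = N" using e x by (auto simp: inj_on_def)
    then show "x \<in> N" using x coset_join1 N.subset N.subgroup_axioms by blast
  next
    fix x assume x: "x \<in> N"
    then have "N #> x = N" using coset_join2 N.subgroup_axioms N.subset by blast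
    then show "x \<in> kernel G ?G' h"
      using x N.subset by (auto simp: kernel_def h_def image_group_one)
  qed
  ultimately show ?thesis by (rule that)
qed

text \<open>The transfer into a central subgroup of index \<open>m\<close> restricts to \<open>z \<mapsto> z\<^sup>m\<close> on
  that subgroup, so for coprime orders its kernel is a normal complement.\<close>

lemma (in finite_group) central_complement:
  assumes Z: "subgroup Z G"
    and central: "\<And>z g. z \<in> Z \<Longrightarrow> g \<in> carrier G \<Longrightarrow> z \<otimes> g = g \<otimes> z"
    and ord: "order G = m * card Z" and cop: "coprime m (card Z)"
  shows "\<exists>L. L \<lhd> G \<and> card L = m"
proof -
  interpret Z: subgroup Z G by fact
  interpret ZG: comm_group "G\<lparr>carrier := Z\<rparr>"
    using subgroup_imp_group[OF Z] central
    by (intro group.group_comm_groupI) auto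
  let ?C = "rcosets Z"
  have finC: "finite ?C" using fin by (simp add: RCOSETS_def)
  have "card Z > 0"
    using Z.one_closed finite_subset[OF Z.subset fin] card_gt_0_iff by blast
  then have cardC: "card ?C = m" using lagrange[OF Z] ord by simp
  define rep :: "'a set \<Rightarrow> 'a" where "rep = (\<lambda>C. SOME x. x \<in> C)"
  have rep: "rep C \<in> C" if "C \<in> ?C" for C
    unfolding rep_def by (rule someI_ex) (use Z.rcosets_non_empty[OF that] in blast)
  have rep_car: "rep C \<in> carrier G" if "C \<in> ?C" for C
    using rep[OF that] Z.rcosets_carrier[OF is_group that] by blast
  have rep_coset: "Z #> rep C = C" if "C \<in> ?C" for C
  proof -
    obtain x where x: "x \<in> carrier G" "C = Z #> x" using \<open>C \<in> ?C\<close> by (auto simp: RCOSETS_def)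
    then show ?thesis using rep[OF that] repr_independence[OF _ x(1) Z] by simp
  qed
  have shift: "C #> g \<in> ?C" if "C \<in> ?C" "g \<in> carrier G" for C g
    using that Z.subset by (auto simp: RCOSETS_def coset_mult_assoc)
  \<comment> \<open>The element of \<open>Z\<close> by which \<open>rep C\<close> times
    \<open>g\<close> differs from the representative of its coset; the transfer is the product of
    these over all cosets.\<close>
  define t where "t = (\<lambda>g C. rep C \<otimes> g \<otimes> inv (rep (C #> g)))"
  have tZ: "t g C \<in> Z" if "C \<in> ?C" "g \<in> carrier G" for g C
  proof -
    have "Z #> (rep C \<otimes> g) = C #> g"
      using coset_mult_assoc[OF Z.subset rep_car[OF that(1)] that(2)] rep_coset[OF that(1)] by simp
    also have "\<dots> = Z #> rep (C #> g)" using rep_coset[OF shift[OF that]] by simp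
    finally have "rep C \<otimes> g \<in> Z #> rep (C #> g)"
      using rcos_self[OF _ Z, of "rep C \<otimes> g"] rep_car[OF that(1)] that(2) by simp
    then show ?thesis
      using Z.rcos_module_imp[OF is_group rep_car[OF shift[OF that]]] by (simp add: t_def)
  qed
  define V where "V = (\<lambda>g. finprod (G\<lparr>carrier := Z\<rparr>) (t g) ?C)"
  have V_hom: "V \<in> hom G (G\<lparr>carrier := Z\<rparr>)"
  proof (rule homI)
    fix g assume "g \<in> carrier G"
    then have "t g \<in> ?C \<rightarrow> Z" using tZ by auto
    then show "V g \<in> carrier (G\<lparr>carrier := Z\<rparr>)"
      unfolding V_def using ZG.finprod_closed by simp
  next
    fix g h assume g: "g \<in> carrier G" and h: "h \<in> carrier G"
    \<comment> \<open>Right multiplication by \<open>g\<close> permutes the cosets, which permits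
      reindexing the product.\<close>
    have inj: "inj_on (\<lambda>C. C #> g) ?C"
    proof (rule inj_onI)
      fix C D assume CD: "C \<in> ?C" "D \<in> ?C" "C #> g = D #> g"
      then have "C \<subseteq> carrier G" "D \<subseteq> carrier G" using Z.rcosets_carrier[OF is_group] by auto
      then have "C = C #> g #> inv g" "D = D #> g #> inv g"
        using g by (auto simp: coset_mult_assoc)
      then show "C = D" using CD(3) by simp
    qed
    then have img: "(\<lambda>C. C #> g) ` ?C = ?C"
      using finC shift g by (intro endo_inj_surj) auto
    \<comment> \<open>A cocycle identity: the representative of the intermediate coset
      \<open>C #> g\<close> cancels.\<close>
    have split: "t (g \<otimes> h) C = t g C \<otimes> t h (C #> g)" if C: "C \<in> ?C" for C
    proof -
      have "C \<subseteq> carrier G" using C Z.rcosets_carrier[OF is_group] by auto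
      then have cgh: "C #> g #> h = C #> (g \<otimes> h)" using g h by (simp add: coset_mult_assoc)
      define a b c where "a = rep C" "b = rep (C #> g)" "c = rep (C #> (g \<otimes> h))"
      have abc: "a \<in> carrier G" "b \<in> carrier G" "c \<in> carrier G"
        unfolding a_b_c_def using rep_car shift C g h by auto
      have "inv b \<otimes> (b \<otimes> (h \<otimes> inv c)) = h \<otimes> inv c"
        using abc g h by (simp add: m_assoc[symmetric])
      then show ?thesis
        using abc g h unfolding t_def cgh a_b_c_def[symmetric] by (simp add: m_assoc)
    qed
    have "V (g \<otimes> h) = finprod (G\<lparr>carrier := Z\<rparr>) (\<lambda>C. t g C \<otimes>\<^bsub>G\<lparr>carrier := Z\<rparr>\<^esub> t h (C #> g)) ?C"
      unfolding V_def using tZ g h shift split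
      by (intro ZG.finprod_cong') auto
    also have "\<dots> = V g \<otimes>\<^bsub>G\<lparr>carrier := Z\<rparr>\<^esub> finprod (G\<lparr>carrier := Z\<rparr>) (\<lambda>C. t h (C #> g)) ?C"
      unfolding V_def using tZ g h shift by (intro ZG.finprod_multf) auto
    also have "finprod (G\<lparr>carrier := Z\<rparr>) (\<lambda>C. t h (C #> g)) ?C = V h"
      using ZG.finprod_reindex[of "t h" "\<lambda>C. C #> g" ?C] inj img tZ h by (simp add: V_def Pi_def)
    finally show "V (g \<otimes> h) = V g \<otimes>\<^bsub>G\<lparr>carrier := Z\<rparr>\<^esub> V h" .
  qed
  interpret V: group_hom G "G\<lparr>carrier := Z\<rparr>" V
    using V_hom is_group ZG.is_group by (simp add: group_hom_def group_hom_axioms_def)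
  \<comment> \<open>A central \<open>z\<close> in \<open>Z\<close> fixes every coset, so each of the
    \<open>m\<close> factors is \<open>z\<close> itself.\<close>
  have V_Z: "V z = z [^] m" if z: "z \<in> Z" for z
  proof -
    have zc: "z \<in> carrier G" using z Z.subset by blast
    have "t z C = z" if C: "C \<in> ?C" for C
    proof -
      have "rep C \<otimes> z \<in> Z #> rep C"
        using central[OF z rep_car[OF C]] z by (auto simp: r_coset_def intro!: bexI[of _ z])
      then have "Z #> (rep C \<otimes> z) = Z #> rep C"
        using repr_independence[OF _ rep_car[OF C] Z] by simp
      then have "C #> z = C"
        using coset_mult_assoc[OF Z.subset rep_car[OF C] zc] rep_coset[OF C] by simp
      then show ?thesis
        using central[OF z rep_car[OF C]] rep_car[OF C] zc
        by (simp add: t_def m_assoc[of z "rep C"] flip: central[OF z])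
    qed
    then have "V z = finprod (G\<lparr>carrier := Z\<rparr>) (\<lambda>C. z) ?C"
      unfolding V_def using z by (intro ZG.finprod_cong') auto
    also have "\<dots> = z [^] m"
      using ZG.finprod_const[of z ?C] z cardC by (simp add: nat_pow_consistent[symmetric])
    finally show ?thesis .
  qed
  have "inj_on V Z"
  proof (rule inj_onI)
    fix a b assume ab: "a \<in> Z" "b \<in> Z" "V a = V b"
    define c where "c = a \<otimes> inv b"
    have c: "c \<in> Z" using ab by (simp add: c_def)
    have "V c = \<one>"
      using ab Z.subset V.hom_mult[of a "inv b"] V.hom_inv[of b] ZG.r_inv[of "V b"]
        V.hom_closed[of b] unfolding c_def by (auto simp: subsetD)
    then have "c [^] m = \<one>" using V_Z c by simp
    then have "c = \<one>"
      using eq_one_of_coprime_pows[OF _ _ subgroup_pow_card[OF Z c] cop] c Z.subset by blast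
    then show "a = b" using ab Z.subset inv_equality[of a "inv b"] by (auto simp: c_def subsetD)
  qed
  then have "V ` Z = Z"
    using finite_subset[OF Z.subset fin] V_hom Z.subset
    by (intro endo_inj_surj) (auto simp: hom_def)
  then have surj: "V ` carrier G = carrier (G\<lparr>carrier := Z\<rparr>)"
    using image_mono[OF Z.subset, of V] V_hom by (auto simp: hom_def)
  let ?L = "kernel G (G\<lparr>carrier := Z\<rparr>) V"
  have "{x \<in> carrier G. V x \<in> Z} = carrier G" using V_hom by (auto simp: hom_def)
  then have "order G = card Z * card ?L"
    using V.card_vimage_surj[OF surj fin, of Z] by (simp add: order_def)
  then have "card ?L = m" using ord \<open>card Z > 0\<close> by simp
  then show ?thesis using V.normal_kernel by blast
qed

subsection \<open>Solvable groups with few solutions of \<open>x\<^sup>m = 1\<close>\<close>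

definition roots :: "('a, 'm) monoid_scheme \<Rightarrow> nat \<Rightarrow> 'a set" where
  "roots G m = {x \<in> carrier G. x [^]\<^bsub>G\<^esub> m = \<one>\<^bsub>G\<^esub>}"

lemma (in finite_group) finite_roots [simp]: "finite (roots G m)"
  by (rule finite_subset[OF _ fin]) (auto simp: roots_def)

lemma (in group) conj_roots:
  "g \<in> carrier G \<Longrightarrow> x \<in> roots G m \<Longrightarrow> g \<otimes> x \<otimes> inv g \<in> roots G m"
  by (simp add: roots_def pow_conj)

text \<open>On an abelian subgroup the k-th power map is multiplicative, so its kernel is a
  subgroup, and conjugation preserves it.\<close>

lemma (in group) normal_abelian_roots:
  assumes A: "A \<lhd> G" and comm: "\<And>a b. a \<in> A \<Longrightarrow> b \<in> A \<Longrightarrow> a \<otimes> b = b \<otimes> a"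
  shows "A \<inter> roots G k \<lhd> G"
proof (rule normal_invI)
  have sA: "subgroup A G" using A by (rule normal_imp_subgroup)
  note car = subgroup.mem_carrier[OF sA]
  show "subgroup (A \<inter> roots G k) G"
  proof (rule subgroupI)
    have "\<one> \<in> A \<inter> roots G k" using subgroup.one_closed[OF sA] by (simp add: roots_def)
    then show "A \<inter> roots G k \<noteq> {}" by blast
  next
    fix a b assume "a \<in> A \<inter> roots G k" "b \<in> A \<inter> roots G k"
    then show "a \<otimes> b \<in> A \<inter> roots G k"
      using pow_mult_distrib[OF comm[of a b], of k] subgroup.m_closed[OF sA]
      by (simp add: roots_def)
  qed (auto simp: roots_def nat_pow_inv subgroup.m_inv_closed[OF sA])
  fix g a assume "g \<in> carrier G" "a \<in> A \<inter> roots G k"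
  then show "g \<otimes> a \<otimes> inv g \<in> A \<inter> roots G k"
    using normal.inv_op_closed2[OF A] conj_roots by blast
qed

text \<open>For \<open>N\<close> of order prime to \<open>m\<close>, a coset of \<open>N\<close> whose \<open>m\<close>-th power is trivial contains an
  element whose \<open>m\<close>-th power is trivial: a suitable power of any representative.\<close>

lemma (in group_hom) roots_subset_image:
  assumes surj: "h ` carrier G = carrier H" and cop: "coprime m (card (kernel G H h))"
  shows "roots H m \<subseteq> h ` roots G m"
proof
  fix y assume y: "y \<in> roots H m"
  have "y \<in> h ` carrier G" unfolding surj using y by (simp add: roots_def)
  then obtain g where g: "g \<in> carrier G" "y = h g" by blast
  let ?c = "card (kernel G H h)"
  \<comment> \<open>The first congruence gives \<open>y [^] k = y\<close>; the second makes the m-th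
    power of \<open>g [^] k\<close> a power of an element of the kernel to the order of the
    kernel.\<close>
  obtain k where k: "[k = 1] (mod m)" "[k = 0] (mod ?c)"
    using binary_chinese_remainder_nat[OF cop] by blast
  obtain e where e: "k = ?c * e" using k(2) by (auto simp: cong_0_iff)
  have "g [^] m \<in> kernel G H h" using y g by (simp add: roots_def kernel_def hom_nat_pow)
  then have "(g [^] m) [^] ?c = \<one>" by (rule G.subgroup_pow_card[OF subgroup_kernel])
  then have "(g [^] k) [^] m = \<one>"
    using g by (simp add: e G.nat_pow_pow) (metis G.nat_pow_one G.nat_pow_pow mult.assoc mult.commute)
  then have "g [^] k \<in> roots G m" using g by (simp add: roots_def)
  moreover have "H.ord y dvd m" using y H.pow_eq_id by (auto simp: roots_def)
  then have "[k = 1] (mod H.ord y)" using k(1) by (rule cong_dvd_modulus_nat[rotated])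
  then have "y [^]\<^bsub>H\<^esub> k = y"
    using H.pow_eq_iff_cong[of y k 1] y by (simp add: roots_def)
  then have "h (g [^] k) = y" using g by (simp add: hom_nat_pow)
  ultimately show "y \<in> h ` roots G m" by blast
qed

text \<open>The inductive step for a kernel of order prime to \<open>m\<close>. The complement of
  the kernel in the preimage of \<open>K\<close> turns out to be the set of all solutions, hence is
  normal in the whole of \<open>G\<close>.\<close>

lemma normal_of_card_roots_coprime_kernel:
  fixes G :: "('a, 'm) monoid_scheme" and H :: "('b, 'n) monoid_scheme"
  assumes "finite_group G" "finite_group H" and hom: "group_hom G H h"
    and surj: "h ` carrier G = carrier H"
    and cop: "coprime m (card (kernel G H h))"
    and comm: "\<And>a b. a \<in> kernel G H h \<Longrightarrow> b \<in> kernel G H h \<Longrightarrow> a \<otimes>\<^bsub>G\<^esub> b = b \<otimes>\<^bsub>G\<^esub> a"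
    and le: "card (roots G m) \<le> m" and K: "K \<lhd> H" "card K = m"
  shows "\<exists>N. N \<lhd> G \<and> card N = m"
proof -
  interpret G: finite_group G by fact
  interpret H: finite_group H by fact
  interpret h: group_hom G H h by fact
  let ?N = "kernel G H h"
  let ?R = "roots G m"
  let ?K = "{x \<in> carrier G. h x \<in> K}"
  have sK: "subgroup K H" using K(1) by (rule normal_imp_subgroup)
  have sN: "subgroup ?N G" by (rule h.subgroup_kernel)
  have nK: "?K \<lhd> G" using K(1) by (rule h.normal_vimage)
  then have sK': "subgroup ?K G" by (rule normal_imp_subgroup)
  have cK: "card ?K = m * card ?N"
    using h.card_vimage_surj[OF surj G.fin subgroup.subset[OF sK]] K(2) by simp
  have "K \<subseteq> roots H m"
    using H.subgroup_pow_card[OF sK] K(2) subgroup.subset[OF sK] by (auto simp: roots_def)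
  then have KR: "K \<subseteq> h ` ?R" using h.roots_subset_image[OF surj cop] by blast
  have "card (h ` ?R) \<le> card ?R" by (rule card_image_le) simp
  then have "K = h ` ?R"
    using KR le K(2) by (intro card_seteq) auto
  moreover have "card ?R = m"
    using \<open>K = h ` ?R\<close> K(2) le card_image_le[OF G.finite_roots, of h m] by simp
  ultimately have inj: "inj_on h ?R" using K(2) by (intro eq_card_imp_inj_on) auto
  \<comment> \<open>Conjugating a solution by an element of the kernel gives a solution with the
    same image, hence the same one.\<close>
  have commR: "a \<otimes>\<^bsub>G\<^esub> x = x \<otimes>\<^bsub>G\<^esub> a" if a: "a \<in> ?N" and x: "x \<in> ?R" for a x
  proof -
    have c: "a \<in> carrier G" "x \<in> carrier G" using a x by (auto simp: kernel_def roots_def)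
    have "h (a \<otimes>\<^bsub>G\<^esub> x \<otimes>\<^bsub>G\<^esub> inv\<^bsub>G\<^esub> a) = h x" using c a by (simp add: kernel_def)
    then have "a \<otimes>\<^bsub>G\<^esub> x \<otimes>\<^bsub>G\<^esub> inv\<^bsub>G\<^esub> a = x"
      using inj G.conj_roots[OF c(1) x] x by (auto simp: inj_on_def)
    then show ?thesis using c by (metis G.inv_solve_right G.m_closed)
  qed
  have central: "a \<otimes>\<^bsub>G\<^esub> k = k \<otimes>\<^bsub>G\<^esub> a" if a: "a \<in> ?N" and k: "k \<in> ?K" for a k
  proof -
    have "h k \<in> h ` ?R" using k \<open>K = h ` ?R\<close> by simp
    then obtain x where x: "x \<in> ?R" "h k = h x" by blast
    have c: "a \<in> carrier G" "x \<in> carrier G" "k \<in> carrier G"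
      using a x k by (auto simp: kernel_def roots_def)
    define b where "b = k \<otimes>\<^bsub>G\<^esub> inv\<^bsub>G\<^esub> x"
    have b: "b \<in> ?N" using c x by (simp add: b_def kernel_def)
    then have bc: "b \<in> carrier G" by (simp add: kernel_def)
    have kb: "k = b \<otimes>\<^bsub>G\<^esub> x" using c by (simp add: b_def G.m_assoc)
    have "a \<otimes>\<^bsub>G\<^esub> (b \<otimes>\<^bsub>G\<^esub> x) = b \<otimes>\<^bsub>G\<^esub> a \<otimes>\<^bsub>G\<^esub> x"
      using comm[OF a b] c bc by (simp flip: G.m_assoc)
    also have "\<dots> = b \<otimes>\<^bsub>G\<^esub> (x \<otimes>\<^bsub>G\<^esub> a)"
      using commR[OF a x(1)] c bc by (simp add: G.m_assoc)
    also have "\<dots> = b \<otimes>\<^bsub>G\<^esub> x \<otimes>\<^bsub>G\<^esub> a" using c bc by (simp add: G.m_assoc)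
    finally show ?thesis by (simp add: kb)
  qed
  interpret KG: finite_group "G\<lparr>carrier := ?K\<rparr>"
    using G.subgroup_imp_group[OF sK'] by (simp add: finite_group_def finite_group_axioms_def)
  have "?N \<subseteq> ?K" using subgroup.one_closed[OF sK] by (auto simp: kernel_def)
  then have "subgroup ?N (G\<lparr>carrier := ?K\<rparr>)"
    using sN sK' G.subgroup_incl by blast
  then obtain L where L: "L \<lhd> G\<lparr>carrier := ?K\<rparr>" "card L = m"
    using KG.central_complement[of ?N m] central cK cop by (auto simp: order_def)
  have sL: "subgroup L G"
    using G.incl_subgroup[OF sK' normal_imp_subgroup[OF L(1)]] .
  \<comment> \<open>So far \<open>L\<close> is normal only in the preimage of \<open>K\<close>; as
    the set of solutions it is invariant under all conjugations.\<close>
  have "L \<subseteq> ?R"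
    using G.subgroup_pow_card[OF sL] L(2) subgroup.subset[OF sL] by (auto simp: roots_def)
  then have "L = ?R" using le L(2) by (intro card_seteq) auto
  then have "L \<lhd> G" using sL G.conj_roots by (intro G.normal_invI) auto
  then show ?thesis using L(2) by blast
qed

text \<open>Passing to quotients changes the carrier type, so the induction is over groups on \<^typ>\<open>nat\<close>.\<close>

lemma solvable_card_roots_nat:
  fixes G :: "nat monoid"
  assumes "finite_group G" "solvable G" "order G = m * n" "coprime m n" "card (roots G m) \<le> m"
  shows "\<exists>N. N \<lhd> G \<and> card N = m"
  using assms
proof (induction "order G" arbitrary: G m n rule: less_induct)
  case less
  interpret finite_group G by fact
  have ord0: "order G > 0" using fin order_gt_0_iff_finite by blast
  then have mn0: "m > 0" "n > 0" using less.prems(3) by auto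
  show ?case
  proof (cases "carrier G = {\<one>\<^bsub>G\<^esub>}")
    case True
    then have "m = 1" using less.prems(3) by (simp add: order_def)
    then show ?thesis using one_is_normal by (intro exI[of _ "{\<one>\<^bsub>G\<^esub>}"]) simp
  next
    case False
    obtain A where A: "A \<lhd> G" "A \<noteq> {\<one>\<^bsub>G\<^esub>}"
      and comm: "\<And>a b. a \<in> A \<Longrightarrow> b \<in> A \<Longrightarrow> a \<otimes>\<^bsub>G\<^esub> b = b \<otimes>\<^bsub>G\<^esub> a"
      using solvable_imp_abelian_normal[OF less.prems(2) False] by blast
    have sA: "subgroup A G" using A(1) by (rule normal_imp_subgroup)
    \<comment> \<open>For \<open>a\<close> in \<open>A\<close>, the power \<open>a [^] m\<close> is
      killed by \<open>n\<close>; if it is trivial, \<open>a\<close> itself is killed by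
      \<open>m\<close>.\<close>
    have "A \<inter> roots G m \<noteq> {\<one>\<^bsub>G\<^esub>} \<or> A \<inter> roots G n \<noteq> {\<one>\<^bsub>G\<^esub>}"
    proof (rule ccontr)
      assume "\<not> ?thesis"
      then have triv: "A \<inter> roots G m = {\<one>\<^bsub>G\<^esub>}" "A \<inter> roots G n = {\<one>\<^bsub>G\<^esub>}" by auto
      have "a = \<one>\<^bsub>G\<^esub>" if a: "a \<in> A" for a
      proof -
        have ac: "a \<in> carrier G" using a subgroup.mem_carrier[OF sA] by blast
        have "(a [^]\<^bsub>G\<^esub> m) [^]\<^bsub>G\<^esub> n = \<one>\<^bsub>G\<^esub>"
          using pow_order_eq_1[OF ac] less.prems(3) ac by (simp add: nat_pow_pow)
        then have "a [^]\<^bsub>G\<^esub> m \<in> A \<inter> roots G n"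
          using ac subgroup_nat_pow_closed[OF sA a] by (simp add: roots_def)
        then have "a [^]\<^bsub>G\<^esub> m = \<one>\<^bsub>G\<^esub>" using triv(2) by simp
        then have "a \<in> A \<inter> roots G m" using a ac by (simp add: roots_def)
        then show ?thesis using triv(1) by simp
      qed
      then have "A = {\<one>\<^bsub>G\<^esub>}" using subgroup.one_closed[OF sA] by blast
      then show False using A(2) by simp
    qed
    then obtain k where k: "k = m \<or> k = n" and nt: "A \<inter> roots G k \<noteq> {\<one>\<^bsub>G\<^esub>}" by blast
    define N where "N = A \<inter> roots G k"
    have N: "N \<lhd> G" unfolding N_def using normal_abelian_roots[OF A(1) comm] by blast
    have sN: "subgroup N G" using N by (rule normal_imp_subgroup)
    have finN: "finite N" by (simp add: N_def)
    have cN: "card N > 1"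
    proof (rule ccontr)
      assume "\<not> card N > 1"
      then have "card N \<le> card {\<one>\<^bsub>G\<^esub>}" by simp
      then have "{\<one>\<^bsub>G\<^esub>} = N"
        using subgroup.one_closed[OF sN] finN by (intro card_seteq) auto
      then show False using nt N_def by simp
    qed
    obtain G' :: "nat monoid" and h where G': "finite_group G'" and hom: "group_hom G G' h"
      and surj: "h ` carrier G = carrier G'" and ker: "kernel G G' h = N"
      using obtains_nat_quotient[OF N] by blast
    interpret G': finite_group G' by fact
    interpret h: group_hom G G' h by fact
    have solv: "solvable G'" using h.surj_hom_imp_solvable[OF surj less.prems(2)] .
    have "{x \<in> carrier G. h x \<in> carrier G'} = carrier G" by auto
    then have ord: "order G = order G' * card N"
      using h.card_vimage_surj[OF surj fin, of "carrier G'"] ker by (simp add: order_def)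
    then have less': "order G' < order G" using cN ord0 by simp
    have exp: "x [^]\<^bsub>G\<^esub> k = \<one>\<^bsub>G\<^esub>" if "x \<in> N" for x
      using that by (simp add: N_def roots_def)
    have dvd: "card N dvd m * n" using ord less.prems(3) by (metis dvd_triv_right)
    show ?thesis
    proof (cases "k = m")
      case True
      have "coprime (card N) n"
        using coprime_card_of_exponent[OF sN finN] exp less.prems(4) True by blast
      then have "card N dvd m" using dvd by (simp add: coprime_dvd_mult_left_iff)
      then obtain m' where m': "m = m' * card N" by (metis dvdE mult.commute)
      \<comment> \<open>Each solution for m' in the quotient accounts for a whole coset of solutions
        for m in \<open>G\<close>, so the quotient has at most m' of them.\<close>
      have "{x \<in> carrier G. h x \<in> roots G' m'} \<subseteq> roots G m"
      proof
        fix x assume "x \<in> {x \<in> carrier G. h x \<in> roots G' m'}"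
        then have x: "x \<in> carrier G" "x [^]\<^bsub>G\<^esub> m' \<in> N"
          using ker[symmetric] by (auto simp: roots_def kernel_def h.hom_nat_pow)
        then have "(x [^]\<^bsub>G\<^esub> m') [^]\<^bsub>G\<^esub> card N = \<one>\<^bsub>G\<^esub>" using subgroup_pow_card[OF sN] by blast
        then show "x \<in> roots G m" using x by (simp add: roots_def nat_pow_pow m')
      qed
      then have "card {x \<in> carrier G. h x \<in> roots G' m'} \<le> card (roots G m)"
        by (intro card_mono) auto
      moreover have "roots G' m' \<subseteq> carrier G'" by (auto simp: roots_def)
      then have "card {x \<in> carrier G. h x \<in> roots G' m'} = card (roots G' m') * card N"
        using h.card_vimage_surj[OF surj fin] ker by simp
      ultimately have "card (roots G' m') * card N \<le> m' * card N"
        using less.prems(5) m' by linarith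
      then have "card (roots G' m') \<le> m'" using cN by simp
      moreover have "order G' = m' * n" using ord less.prems(3) m' cN by simp
      moreover have "coprime m' n" using less.prems(4) m' by simp
      ultimately obtain K where K: "K \<lhd> G'" "card K = m'"
        using less.hyps[OF less' G' solv] by blast
      have "card {x \<in> carrier G. h x \<in> K} = m"
        using h.card_vimage_surj[OF surj fin, of K] K ker m'
          subgroup.subset[OF normal_imp_subgroup[OF K(1)]] by simp
      then show ?thesis using h.normal_vimage[OF K(1)] by blast
    next
      case False
      then have "coprime (card N) m"
        using coprime_card_of_exponent[OF sN finN] exp less.prems(4) k coprime_commute by metis
      then have cop: "coprime m (card N)" by (simp add: coprime_commute)
      have "card N dvd n" using dvd \<open>coprime (card N) m\<close> by (simp add: coprime_dvd_mult_right_iff)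
      then obtain n' where n': "n = n' * card N" by (metis dvdE mult.commute)
      \<comment> \<open>Here \<open>m\<close> stays and \<open>n\<close> shrinks: solutions in the
        quotient lift to \<open>G\<close>, so the bound is inherited.\<close>
      have "card (roots G' m) \<le> card (h ` roots G m)"
        using h.roots_subset_image[OF surj] cop ker by (intro card_mono) auto
      also have "\<dots> \<le> card (roots G m)" by (rule card_image_le) simp
      finally have "card (roots G' m) \<le> m" using less.prems(5) by simp
      moreover have "order G' = m * n'" using ord less.prems(3) n' cN by simp
      moreover have "coprime m n'" using less.prems(4) n' by simp
      ultimately obtain K where K: "K \<lhd> G'" "card K = m"
        using less.hyps[OF less' G' solv] by blast
      have "a \<otimes>\<^bsub>G\<^esub> b = b \<otimes>\<^bsub>G\<^esub> a" if "a \<in> N" "b \<in> N" for a b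
        using comm that by (simp add: N_def)
      then show ?thesis
        using normal_of_card_roots_coprime_kernel[OF less.prems(1) G' hom surj _ _ less.prems(5) K]
          cop ker by blast
    qed
  qed
qed

text \<open>Dividing by the trivial subgroup yields an isomorphic copy of \<open>G\<close> on the
  natural numbers.\<close>

lemma (in finite_group) solvable_card_roots:
  assumes "solvable G" "order G = m * n" "coprime m n" "card (roots G m) \<le> m"
  shows "\<exists>N. N \<lhd> G \<and> card N = m"
proof -
  obtain G' :: "nat monoid" and h where G': "finite_group G'" and hom: "group_hom G G' h"
    and surj: "h ` carrier G = carrier G'" and ker: "kernel G G' h = {\<one>}"
    using obtains_nat_quotient[OF one_is_normal] by blast
  interpret h: group_hom G G' h by fact
  have card: "card {x \<in> carrier G. h x \<in> S} = card S" if "S \<subseteq> carrier G'" for S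
    using h.card_vimage_surj[OF surj fin that] ker by simp
  have inj: "h x = \<one>\<^bsub>G'\<^esub> \<longleftrightarrow> x = \<one>" if "x \<in> carrier G" for x
    using ker that by (auto simp: kernel_def)
  have "{x \<in> carrier G. h x \<in> carrier G'} = carrier G" by auto
  then have "order G' = m * n" using card[of "carrier G'"] assms(2) by (simp add: order_def)
  moreover have "{x \<in> carrier G. h x \<in> roots G' m} = roots G m"
    by (auto simp: roots_def inj simp flip: h.hom_nat_pow)
  then have "card (roots G' m) \<le> m" using card[of "roots G' m"] assms(4) by (simp add: roots_def)
  ultimately obtain K where K: "K \<lhd> G'" "card K = m"
    using solvable_card_roots_nat[OF G' h.surj_hom_imp_solvable[OF surj assms(1)] _ assms(3)] by blast
  then have "card {x \<in> carrier G. h x \<in> K} = m"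
    using card subgroup.subset[OF normal_imp_subgroup[OF K(1)]] by simp
  then show ?thesis using h.normal_vimage[OF K(1)] by blast
qed

text \<open>The image of a solution in the quotient by \<open>K\<close> is killed by the coprime
  numbers \<open>card K\<close> and \<open>n\<close>, so all solutions lie in
  \<open>K\<close>.\<close>

lemma (in finite_group) normal_hall_card_roots:
  assumes K: "K \<lhd> G" and ord: "order G = card K * n" and cop: "coprime (card K) n"
  shows "card (roots G (card K)) \<le> card K"
proof -
  obtain G' :: "nat monoid" and h where G': "finite_group G'" and hom: "group_hom G G' h"
    and surj: "h ` carrier G = carrier G'" and ker: "kernel G G' h = K"
    using obtains_nat_quotient[OF K] by blast
  interpret G': finite_group G' by fact
  interpret h: group_hom G G' h by fact
  have sK: "subgroup K G" using K by (rule normal_imp_subgroup)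
  have finK: "finite K" using finite_subset[OF subgroup.subset[OF sK] fin] .
  then have "card K > 0" using subgroup.one_closed[OF sK] card_gt_0_iff by blast
  have "{x \<in> carrier G. h x \<in> carrier G'} = carrier G" by auto
  then have "order G = order G' * card K"
    using h.card_vimage_surj[OF surj fin, of "carrier G'"] ker by (simp add: order_def)
  then have ord': "order G' = n" using ord \<open>card K > 0\<close> by simp
  have "roots G (card K) \<subseteq> K"
  proof
    fix x assume "x \<in> roots G (card K)"
    then have x: "x \<in> carrier G" "h x [^]\<^bsub>G'\<^esub> card K = \<one>\<^bsub>G'\<^esub>"
      by (auto simp: roots_def simp flip: h.hom_nat_pow)
    moreover have "h x [^]\<^bsub>G'\<^esub> n = \<one>\<^bsub>G'\<^esub>" using G'.pow_order_eq_1[of "h x"] x ord' by simp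
    ultimately have "h x = \<one>\<^bsub>G'\<^esub>" using G'.eq_one_of_coprime_pows cop h.hom_closed by blast
    then show "x \<in> K" using x ker by (auto simp: kernel_def)
  qed
  then show ?thesis using finK by (rule card_mono[rotated])
qed

theorem corollary3p4:
  fixes G :: "('a, 'm) monoid_scheme" and H :: "('b, 'n) monoid_scheme" and m :: nat
  assumes "group G" and "finite (carrier G)"
    and "group H" and "finite (carrier H)"
    and "m > 0"
    and "digraph_iso (with_proj (power_graph G)) (with_proj (power_graph H))"
    and "\<exists>K. K \<lhd> H \<and> hall_subgroup K H \<and> card K = m"
    and "solvable G"
  shows "\<exists>N. N \<lhd> G \<and> hall_subgroup N G \<and> card N = m"
proof -
  interpret G: finite_group G
    using assms(1,2) by (simp add: finite_group_def finite_group_axioms_def)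
  interpret H: finite_group H
    using assms(3,4) by (simp add: finite_group_def finite_group_axioms_def)
  obtain K where K: "K \<lhd> H" "hall_subgroup K H" "card K = m" using assms(7) by blast
  define n where "n = card (rcosets\<^bsub>H\<^esub> K)"
  have cop: "coprime m n" using K by (simp add: hall_subgroup_def n_def)
  have ordH: "order H = m * n"
    using H.lagrange[OF normal_imp_subgroup[OF K(1)]] K(3) by (simp add: n_def mult.commute)
  have "card (roots H m) \<le> m"
    using H.normal_hall_card_roots[OF K(1), of n] ordH cop K(3) by simp
  then have "card (roots G m) \<le> m"
    using card_roots_eq_of_power_graph_iso(1)[OF G.finite_group_axioms H.finite_group_axioms assms(6)]
    by (simp add: roots_def)
  moreover have ordG: "order G = m * n"
    using card_roots_eq_of_power_graph_iso(2)[OF G.finite_group_axioms H.finite_group_axioms assms(6)]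
      ordH by simp
  ultimately obtain N where N: "N \<lhd> G" "card N = m"
    using G.solvable_card_roots[OF assms(8) _ cop] by blast
  have "card (rcosets\<^bsub>G\<^esub> N) * m = n * m"
    using G.lagrange[OF normal_imp_subgroup[OF N(1)]] N(2) ordG by (simp add: mult.commute)
  then have "card (rcosets\<^bsub>G\<^esub> N) = n" using assms(5) by simp
  then have "hall_subgroup N G"
    using N cop normal_imp_subgroup by (simp add: hall_subgroup_def)
  then show ?thesis using N by blast
qed

end
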